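(* There is a constant $c$ such that the following holds. Let $\varphi$ be a formula of size $n+m$, where $n$ is the number of future nodes and propositional nodes in the syntax tree of $\varphi$ and $m$ is the number of past nodes. Then there exists a deterministic Rabin automaton over the alphabet $2^{\mathrm{Var}(\varphi)}$ that accepts exactly the infinite words $w$ over $2^{\mathrm{Var}(\varphi)}$ with $w\models\varphi$, that has at most $2^{2^{c\,(n+m)}}$ states when $n+m\geq 1$ (i.e. $2^{2^{O(n+m)}}$ states), and that has at most $2^n$ Rabin pairs.
   Context: Syntax. Formulae are pLTL formulae in negation normal form: built from $\top,\bot$, literals $p,\neg p$ ($p$ an atomic proposition), $\wedge,\vee$, future operators $\mathbf{X}$ (unary), $\mathbf{U},\mathbf{W},\mathbf{R},\mathbf{M}$ (binary), and past operators $\mathbf{Y},\tilde{\mathbf{Y}}$ (unary), $\mathbf{S},\tilde{\mathbf{S}},\mathbf{B},\tilde{\mathbf{B}}$ (binary). $\mathrm{Var}(\varphi)$ is the set of atomic propositions in $\varphi$. A formula $p$ or $\neg p$ is called propositional; a formula rooted with a future or past operator is temporal. The size of $\varphi$ is the number of nodes of its syntax tree that are temporal or propositional; future (past) nodes are those labelled with a future (past) operator. Semantics. For an infinite word $w=\sigma_0\sigma_1\dots$ over $2^{\mathrm{Var}(\varphi)}$ and $t\in\mathbb{N}$: $(w,t)\models p$ iff $p\in\sigma_t$; Boolean cases as usual; $(w,t)\models\mathbf{X}\psi$ iff $(w,t+1)\models\psi$; $(w,t)\models\mathbf{Y}\psi$ iff $t>0$ and $(w,t-1)\models\psi$; $(w,t)\models\tilde{\mathbf{Y}}\psi$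 iff $t=0$ or $(w,t-1)\models\psi$; $(w,t)\models\psi\mathbf{U}\xi$ iff $\exists r\ge t$ with $(w,r)\models\xi$ and $(w,s)\models\psi$ for all $s\in[t,r)$; $(w,t)\models\psi\mathbf{S}\xi$ iff $\exists r\le t$ with $(w,r)\models\xi$ and $(w,s)\models\psi$ for all $s\in(r,t]$; $\psi\mathbf{W}\xi$ holds at $t$ iff $\psi\mathbf{U}\xi$ holds at $t$ or $\psi$ holds at all $s\ge t$; $\psi\tilde{\mathbf{S}}\xi$ holds at $t$ iff $\psi\mathbf{S}\xi$ holds at $t$ or $\psi$ holds at all $s\le t$; semantically $\psi\mathbf{M}\xi:=\xi\mathbf{U}(\psi\wedge\xi)$, $\psi\mathbf{R}\xi:=\xi\mathbf{W}(\psi\wedge\xi)$, $\psi\mathbf{B}\xi:=\xi\mathbf{S}(\psi\wedge\xi)$, $\psi\tilde{\mathbf{B}}\xi:=\xi\tilde{\mathbf{S}}(\psi\wedge\xi)$. $w\models\varphi$ means $(w,0)\models\varphi$. Automata. A deterministic Rabin automaton over an alphabet $\Sigma$ consists of a finite set $Q$ of states, one initial state, a (partial) transition function $\delta:Q\times\Sigma\to Q$, and a set $R\subseteq 2^Q\times 2^Q$ of Rabin pairs. It accepts an infinite word iff it has an (infinite) run $r$ on the word and there is a pair $(A,B)\in R$ such that, with $\mathrm{Inf}(r)$ the set of states occurring infinitely often in $r$, $\mathrm{Inf}(r)\cap A=\varnothing$ and $\mathrm{Inf}(r)\cap B\neq\varnothing$. *)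

theory Defs
  imports Main "HOL-Library.Omega_Words_Fun"
begin

datatype (Var: 'a) pltl =
    Top
  | Bot
  | Prop 'a
  | NProp 'a
  | And "'a pltl" "'a pltl"
  | Or "'a pltl" "'a pltl"
  | Next "'a pltl"
  | Until "'a pltl" "'a pltl"
  | WUntil "'a pltl" "'a pltl"
  | Release "'a pltl" "'a pltl"
  | MRelease "'a pltl" "'a pltl"
  | Prev "'a pltl"
  | WPrev "'a pltl"
  | Since "'a pltl" "'a pltl"
  | WSince "'a pltl" "'a pltl"
  | Before "'a pltl" "'a pltl"
  | WBefore "'a pltl" "'a pltl"

text \<open>One list entry per node of the syntax tree, namely the subtree rooted at that node;
  a negated proposition is a single leaf.\<close>

primrec nodes :: "'a pltl \<Rightarrow> 'a pltl list" where
  "nodes Top = [Top]"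
| "nodes Bot = [Bot]"
| "nodes (Prop p) = [Prop p]"
| "nodes (NProp p) = [NProp p]"
| "nodes (And \<psi> \<xi>) = And \<psi> \<xi> # nodes \<psi> @ nodes \<xi>"
| "nodes (Or \<psi> \<xi>) = Or \<psi> \<xi> # nodes \<psi> @ nodes \<xi>"
| "nodes (Next \<psi>) = Next \<psi> # nodes \<psi>"
| "nodes (Until \<psi> \<xi>) = Until \<psi> \<xi> # nodes \<psi> @ nodes \<xi>"
| "nodes (WUntil \<psi> \<xi>) = WUntil \<psi> \<xi> # nodes \<psi> @ nodes \<xi>"
| "nodes (Release \<psi> \<xi>) = Release \<psi> \<xi> # nodes \<psi> @ nodes \<xi>"
| "nodes (MRelease \<psi> \<xi>) = MRelease \<psi> \<xi> # nodes \<psi> @ nodes \<xi>"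
| "nodes (Prev \<psi>) = Prev \<psi> # nodes \<psi>"
| "nodes (WPrev \<psi>) = WPrev \<psi> # nodes \<psi>"
| "nodes (Since \<psi> \<xi>) = Since \<psi> \<xi> # nodes \<psi> @ nodes \<xi>"
| "nodes (WSince \<psi> \<xi>) = WSince \<psi> \<xi> # nodes \<psi> @ nodes \<xi>"
| "nodes (Before \<psi> \<xi>) = Before \<psi> \<xi> # nodes \<psi> @ nodes \<xi>"
| "nodes (WBefore \<psi> \<xi>) = WBefore \<psi> \<xi> # nodes \<psi> @ nodes \<xi>"

fun is_propositional :: "'a pltl \<Rightarrow> bool" where
  "is_propositional (Prop _) = True"
| "is_propositional (NProp _) = True"
| "is_propositional _ = False"

fun is_future :: "'a pltl \<Rightarrow> bool" where
  "is_future (Next _) = True"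
| "is_future (Until _ _) = True"
| "is_future (WUntil _ _) = True"
| "is_future (Release _ _) = True"
| "is_future (MRelease _ _) = True"
| "is_future _ = False"

fun is_past :: "'a pltl \<Rightarrow> bool" where
  "is_past (Prev _) = True"
| "is_past (WPrev _) = True"
| "is_past (Since _ _) = True"
| "is_past (WSince _ _) = True"
| "is_past (Before _ _) = True"
| "is_past (WBefore _ _) = True"
| "is_past _ = False"

definition num_future_prop :: "'a pltl \<Rightarrow> nat" where
  "num_future_prop \<phi> = length (filter (\<lambda>\<psi>. is_future \<psi> \<or> is_propositional \<psi>) (nodes \<phi>))"

definition num_past :: "'a pltl \<Rightarrow> nat" where
  "num_past \<phi> = length (filter is_past (nodes \<phi>))"

text \<open>The temporal connectives as operations on predicates over time points.\<close>

definition until_at :: "(nat \<Rightarrow> bool) \<Rightarrow> (nat \<Rightarrow> bool) \<Rightarrow> nat \<Rightarrow> bool" where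
  "until_at P Q t \<longleftrightarrow> (\<exists>r\<ge>t. Q r \<and> (\<forall>s\<in>{t..<r}. P s))"

definition weak_until_at :: "(nat \<Rightarrow> bool) \<Rightarrow> (nat \<Rightarrow> bool) \<Rightarrow> nat \<Rightarrow> bool" where
  "weak_until_at P Q t \<longleftrightarrow> until_at P Q t \<or> (\<forall>s\<ge>t. P s)"

definition since_at :: "(nat \<Rightarrow> bool) \<Rightarrow> (nat \<Rightarrow> bool) \<Rightarrow> nat \<Rightarrow> bool" where
  "since_at P Q t \<longleftrightarrow> (\<exists>r\<le>t. Q r \<and> (\<forall>s\<in>{r<..t}. P s))"

definition weak_since_at :: "(nat \<Rightarrow> bool) \<Rightarrow> (nat \<Rightarrow> bool) \<Rightarrow> nat \<Rightarrow> bool" where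
  "weak_since_at P Q t \<longleftrightarrow> since_at P Q t \<or> (\<forall>s\<le>t. P s)"

primrec sat :: "'a set word \<Rightarrow> nat \<Rightarrow> 'a pltl \<Rightarrow> bool" where
  "sat w t Top \<longleftrightarrow> True"
| "sat w t Bot \<longleftrightarrow> False"
| "sat w t (Prop p) \<longleftrightarrow> p \<in> w t"
| "sat w t (NProp p) \<longleftrightarrow> p \<notin> w t"
| "sat w t (And \<psi> \<xi>) \<longleftrightarrow> sat w t \<psi> \<and> sat w t \<xi>"
| "sat w t (Or \<psi> \<xi>) \<longleftrightarrow> sat w t \<psi> \<or> sat w t \<xi>"
| "sat w t (Next \<psi>) \<longleftrightarrow> sat w (t + 1) \<psi>"
| "sat w t (Until \<psi> \<xi>) \<longleftrightarrow> until_at (\<lambda>s. sat w s \<psi>) (\<lambda>s. sat w s \<xi>) t"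
| "sat w t (WUntil \<psi> \<xi>) \<longleftrightarrow> weak_until_at (\<lambda>s. sat w s \<psi>) (\<lambda>s. sat w s \<xi>) t"
| "sat w t (Release \<psi> \<xi>) \<longleftrightarrow>
     weak_until_at (\<lambda>s. sat w s \<xi>) (\<lambda>s. sat w s \<psi> \<and> sat w s \<xi>) t"
| "sat w t (MRelease \<psi> \<xi>) \<longleftrightarrow>
     until_at (\<lambda>s. sat w s \<xi>) (\<lambda>s. sat w s \<psi> \<and> sat w s \<xi>) t"
| "sat w t (Prev \<psi>) \<longleftrightarrow> t > 0 \<and> sat w (t - 1) \<psi>"
| "sat w t (WPrev \<psi>) \<longleftrightarrow> t = 0 \<or> sat w (t - 1) \<psi>"
| "sat w t (Since \<psi> \<xi>) \<longleftrightarrow> since_at (\<lambda>s. sat w s \<psi>) (\<lambda>s. sat w s \<xi>) t"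
| "sat w t (WSince \<psi> \<xi>) \<longleftrightarrow> weak_since_at (\<lambda>s. sat w s \<psi>) (\<lambda>s. sat w s \<xi>) t"
| "sat w t (Before \<psi> \<xi>) \<longleftrightarrow>
     since_at (\<lambda>s. sat w s \<xi>) (\<lambda>s. sat w s \<psi> \<and> sat w s \<xi>) t"
| "sat w t (WBefore \<psi> \<xi>) \<longleftrightarrow>
     weak_since_at (\<lambda>s. sat w s \<xi>) (\<lambda>s. sat w s \<psi> \<and> sat w s \<xi>) t"

record ('q, 'b) rabin =
  states :: "'q set"
  initial :: 'q
  trans_fun :: "'q \<Rightarrow> 'b \<Rightarrow> 'q option"
  pairs :: "('q set \<times> 'q set) set"

text \<open>The transition function is relevant only on \<open>states A \<times> \<Sigma>\<close>; there, \<open>None\<close> means that it is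
  undefined.\<close>

definition det_rabin :: "'b set \<Rightarrow> ('q, 'b) rabin \<Rightarrow> bool" where
  "det_rabin \<Sigma> A \<longleftrightarrow>
     finite (states A) \<and>
     initial A \<in> states A \<and>
     (\<forall>q\<in>states A. \<forall>\<sigma>\<in>\<Sigma>. \<forall>q'. trans_fun A q \<sigma> = Some q' \<longrightarrow> q' \<in> states A) \<and>
     pairs A \<subseteq> Pow (states A) \<times> Pow (states A)"

definition is_run :: "('q, 'b) rabin \<Rightarrow> 'b word \<Rightarrow> 'q word \<Rightarrow> bool" where
  "is_run A w r \<longleftrightarrow> r 0 = initial A \<and> (\<forall>i. trans_fun A (r i) (w i) = Some (r (Suc i)))"

definition rabin_accepts :: "('q, 'b) rabin \<Rightarrow> 'b word \<Rightarrow> bool" where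
  "rabin_accepts A w \<longleftrightarrow>
     (\<exists>r. is_run A w r \<and> (\<exists>(E, F)\<in>pairs A. limit r \<inter> E = {} \<and> limit r \<inter> F \<noteq> {}))"

definition rabin_language :: "'b set \<Rightarrow> ('q, 'b) rabin \<Rightarrow> 'b word set" where
  "rabin_language \<Sigma> A = {w. range w \<subseteq> \<Sigma> \<and> rabin_accepts A w}"

end

theory Submission
  imports Defs "HOL-Library.FuncSet"
begin

text \<open>For every set \<open>X\<close> of least-fixpoint nodes (\<open>U\<close>, \<open>M\<close>) and greatest-fixpoint nodes (\<open>W\<close>, \<open>R\<close>),
  one Rabin pair checks the guess that the former hold infinitely often and the latter hold from some
  point on. The guess is certified by tableau runs, which start at time 0 and therefore evaluate past
  operators by local constraints. The co-Buchi part asks for one infinite run that claims \<open>\<phi>\<close>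
  initially and from some time on claims all greatest-fixpoint nodes of \<open>X\<close> and no least-fixpoint
  node outside \<open>X\<close>. The Buchi part asks, for arbitrarily large \<open>j\<close>, for a finite run in which every
  least-fixpoint node of \<open>X\<close> is claimed after time \<open>j\<close>, where the greatest-fixpoint nodes of \<open>X\<close> may
  be assumed from time \<open>j\<close> on. Induction on the size of the nodes of \<open>X\<close> shows that the two
  parts justify each other. The first part is made deterministic by the breakpoint construction, the
  second one by a subset construction that restarts with a later \<open>j\<close> whenever it succeeds; taking the
  product over all \<open>X\<close> keeps the size doubly exponential.\<close>

section \<open>Least and greatest fixpoint operators, and subformulas\<close>

fun is_mu :: "'a pltl \<Rightarrow> bool" where
  "is_mu (Until _ _) = True"
| "is_mu (MRelease _ _) = True"
| "is_mu _ = False"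

fun is_nu :: "'a pltl \<Rightarrow> bool" where
  "is_nu (WUntil _ _) = True"
| "is_nu (Release _ _) = True"
| "is_nu _ = False"

lemma is_nu_not_is_mu: "is_nu \<chi> \<Longrightarrow> \<not> is_mu \<chi>"
  by (cases \<chi>) auto

lemma nodes_self [simp]: "\<chi> \<in> set (nodes \<chi>)"
  by (cases \<chi>) auto

lemma nodes_trans: "\<chi> \<in> set (nodes \<phi>) \<Longrightarrow> set (nodes \<chi>) \<subseteq> set (nodes \<phi>)"
  by (induction \<phi>) auto

lemma size_nodes: "\<chi>' \<in> set (nodes \<chi>) \<Longrightarrow> \<chi>' = \<chi> \<or> size \<chi>' < size \<chi>"
  by (induction \<chi>) auto

section \<open>Expansion laws and invariance principles for the temporal connectives\<close>

lemma until_at_unfold: "until_at P Q t \<longleftrightarrow> Q t \<or> P t \<and> until_at P Q (Suc t)"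
proof
  assume "until_at P Q t"
  then obtain r where r: "r \<ge> t" "Q r" "\<forall>s\<in>{t..<r}. P s"
    unfolding until_at_def by blast
  show "Q t \<or> P t \<and> until_at P Q (Suc t)"
  proof (cases "r = t")
    case False
    with r have "Suc t \<le> r" by simp
    then show ?thesis using r by (auto simp: until_at_def intro!: exI[of _ r])
  qed (use r in simp)
next
  assume "Q t \<or> P t \<and> until_at P Q (Suc t)"
  then show "until_at P Q t"
  proof
    assume "P t \<and> until_at P Q (Suc t)"
    then obtain r where "P t" "r \<ge> Suc t" "Q r" "\<forall>s\<in>{Suc t..<r}. P s"
      unfolding until_at_def by blast
    then show ?thesis
      unfolding until_at_def by (intro exI[of _ r]) (auto simp: le_eq_less_or_eq Suc_le_eq)
  qed (auto simp: until_at_def)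
qed

lemma weak_until_at_unfold:
  "weak_until_at P Q t \<longleftrightarrow> Q t \<or> P t \<and> weak_until_at P Q (Suc t)"
proof -
  have "(\<forall>s\<ge>t. P s) \<longleftrightarrow> P t \<and> (\<forall>s\<ge>Suc t. P s)"
    by (metis Suc_leD le_refl not_less_eq_eq order_antisym)
  then show ?thesis
    unfolding weak_until_at_def using until_at_unfold[of P Q t] by blast
qed

lemma since_at_0 [simp]: "since_at P Q 0 \<longleftrightarrow> Q 0"
  by (auto simp: since_at_def)

lemma since_at_Suc [simp]: "since_at P Q (Suc t) \<longleftrightarrow> Q (Suc t) \<or> P (Suc t) \<and> since_at P Q t"
proof
  assume "since_at P Q (Suc t)"
  then obtain r where r: "r \<le> Suc t" "Q r" "\<forall>s\<in>{r<..Suc t}. P s"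
    unfolding since_at_def by blast
  show "Q (Suc t) \<or> P (Suc t) \<and> since_at P Q t"
  proof (cases "r = Suc t")
    case False
    with r have "r \<le> t" by simp
    then show ?thesis using r by (auto simp: since_at_def intro!: exI[of _ r])
  qed (use r in simp)
next
  assume "Q (Suc t) \<or> P (Suc t) \<and> since_at P Q t"
  then show "since_at P Q (Suc t)"
  proof
    assume "P (Suc t) \<and> since_at P Q t"
    then obtain r where "P (Suc t)" "r \<le> t" "Q r" "\<forall>s\<in>{r<..t}. P s"
      unfolding since_at_def by blast
    then show ?thesis
      unfolding since_at_def by (intro exI[of _ r]) (auto simp: le_Suc_eq)
  qed (auto simp: since_at_def)
qed

lemma weak_since_at_0 [simp]: "weak_since_at P Q 0 \<longleftrightarrow> Q 0 \<or> P 0"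
  by (auto simp: weak_since_at_def)

lemma weak_since_at_Suc [simp]:
  "weak_since_at P Q (Suc t) \<longleftrightarrow> Q (Suc t) \<or> P (Suc t) \<and> weak_since_at P Q t"
  unfolding weak_since_at_def by (auto simp: le_Suc_eq)

text \<open>\<open>R\<close> is a pending obligation: as long as \<open>Q\<close> has not occurred,
  it moves on and yields \<open>P\<close>. If it never ends, \<open>fair\<close> supplies a
  \<open>Q\<close>; the least time with \<open>Q\<close> is the witness.\<close>

lemma until_at_of_invariant:
  assumes step: "\<And>s. R s \<Longrightarrow> Q s \<or> P s \<and> R (Suc s)"
    and "R t" and fair: "(\<forall>s\<ge>t. R s) \<Longrightarrow> \<exists>r\<ge>t. Q r"
  shows "until_at P Q t"
proof -
  have R: "R s" if "s \<ge> t" "\<forall>r\<in>{t..<s}. \<not> Q r" for s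
    using that
  proof (induction s rule: dec_induct)
    case (step s)
    then have "R s" "\<not> Q s" by auto
    then show ?case using assms(1) by blast
  qed (use \<open>R t\<close> in simp)
  have "\<exists>r\<ge>t. Q r"
    using R fair by force
  then obtain r where r: "r \<ge> t" "Q r" "\<forall>s. s \<ge> t \<and> Q s \<longrightarrow> r \<le> s"
    using exists_least_iff[of "\<lambda>r. r \<ge> t \<and> Q r"] by (metis not_le)
  have "P s" if "s \<in> {t..<r}" for s
  proof -
    have nQ: "\<not> Q s'" if "s' \<in> {t..<r}" for s'
      using r(3) that by (meson atLeastLessThan_iff not_le)
    have "R s"
      using that nQ by (intro R) auto
    then show ?thesis using step nQ that by blast
  qed
  then show ?thesis
    unfolding until_at_def using r by blast
qed

text \<open>An obligation may also end where the weak until is already known to hold, as happens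
  when the tableau discharges a formula from \<open>N\<close>. If it never ends, \<open>P\<close>
  holds forever; otherwise the expansion law carries the weak until back to
  \<open>t\<close>.\<close>

lemma weak_until_at_of_invariant:
  assumes step: "\<And>s. R s \<Longrightarrow> weak_until_at P Q s \<or> P s \<and> R (Suc s)"
    and "R t"
  shows "weak_until_at P Q t"
proof (cases "\<forall>s\<ge>t. R s \<and> \<not> weak_until_at P Q s")
  case True
  then have "\<forall>s\<ge>t. P s" using step by blast
  then show ?thesis by (simp add: weak_until_at_def)
next
  case False
  have *: "weak_until_at P Q t" if "weak_until_at P Q r" "r \<ge> t" "R t" for r
    using that(2,1,3)
  proof (induction t rule: inc_induct)
    case (step t)
    then show ?case
      using assms(1)[of t] weak_until_at_unfold[of P Q t] by blast
  qed
  have "\<exists>r\<ge>t. weak_until_at P Q r"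
  proof (rule ccontr)
    assume n: "\<not> ?thesis"
    have "R s" if "s \<ge> t" for s
      using that
    proof (induction s rule: dec_induct)
      case (step s)
      then show ?case using assms(1)[of s] n by auto
    qed (rule \<open>R t\<close>)
    with False n show False by auto
  qed
  then show ?thesis using * \<open>R t\<close> by blast
qed

subsection \<open>Tableau runs\<close>

fun holds :: "'a pltl set \<Rightarrow> 'a pltl \<Rightarrow> bool" where
  "holds a Top = True"
| "holds a Bot = False"
| "holds a (And \<psi> \<xi>) = (holds a \<psi> \<and> holds a \<xi>)"
| "holds a (Or \<psi> \<xi>) = (holds a \<psi> \<or> holds a \<xi>)"
| "holds a \<chi> = (\<chi> \<in> a)"

text \<open>That \<open>Until\<close> and \<open>MRelease\<close> are not postponed forever is no
  local condition; it is imposed separately on the runs below.\<close>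

fun future_ok ::
    "'a pltl set \<Rightarrow> 'a pltl set \<Rightarrow> 'a set \<Rightarrow> 'a pltl set \<Rightarrow> 'a pltl \<Rightarrow> bool" where
  "future_ok N a \<sigma> a' (Prop p) = (p \<in> \<sigma>)"
| "future_ok N a \<sigma> a' (NProp p) = (p \<notin> \<sigma>)"
| "future_ok N a \<sigma> a' (Next \<psi>) = holds a' \<psi>"
| "future_ok N a \<sigma> a' (Until \<psi> \<xi>) = (holds a \<xi> \<or> holds a \<psi> \<and> Until \<psi> \<xi> \<in> a')"
| "future_ok N a \<sigma> a' (WUntil \<psi> \<xi>) =
     (WUntil \<psi> \<xi> \<in> N \<or> holds a \<xi> \<or> holds a \<psi> \<and> WUntil \<psi> \<xi> \<in> a')"
| "future_ok N a \<sigma> a' (Release \<psi> \<xi>) =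
     (Release \<psi> \<xi> \<in> N \<or> holds a \<xi> \<and> (holds a \<psi> \<or> Release \<psi> \<xi> \<in> a'))"
| "future_ok N a \<sigma> a' (MRelease \<psi> \<xi>) = (holds a \<xi> \<and> (holds a \<psi> \<or> MRelease \<psi> \<xi> \<in> a'))"
| "future_ok N a \<sigma> a' _ = True"

text \<open>Past claims are checked on entering \<open>a'\<close>, since their expansion laws refer
  to the preceding atom; \<open>init_ok\<close> covers time 0, which has none.\<close>

fun past_ok :: "'a pltl set \<Rightarrow> 'a pltl set \<Rightarrow> 'a pltl \<Rightarrow> bool" where
  "past_ok a a' (Prev \<psi>) = holds a \<psi>"
| "past_ok a a' (WPrev \<psi>) = holds a \<psi>"
| "past_ok a a' (Since \<psi> \<xi>) = (holds a' \<xi> \<or> holds a' \<psi> \<and> Since \<psi> \<xi> \<in> a)"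
| "past_ok a a' (WSince \<psi> \<xi>) = (holds a' \<xi> \<or> holds a' \<psi> \<and> WSince \<psi> \<xi> \<in> a)"
| "past_ok a a' (Before \<psi> \<xi>) = (holds a' \<xi> \<and> (holds a' \<psi> \<or> Before \<psi> \<xi> \<in> a))"
| "past_ok a a' (WBefore \<psi> \<xi>) = (holds a' \<xi> \<and> (holds a' \<psi> \<or> WBefore \<psi> \<xi> \<in> a))"
| "past_ok a a' _ = True"

fun init_ok :: "'a pltl set \<Rightarrow> 'a pltl \<Rightarrow> bool" where
  "init_ok a (Prev \<psi>) = False"
| "init_ok a (Since \<psi> \<xi>) = holds a \<xi>"
| "init_ok a (WSince \<psi> \<xi>) = (holds a \<xi> \<or> holds a \<psi>)"
| "init_ok a (Before \<psi> \<xi>) = (holds a \<psi> \<and> holds a \<xi>)"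
| "init_ok a (WBefore \<psi> \<xi>) = holds a \<xi>"
| "init_ok a _ = True"

definition tableau_step ::
    "'a pltl set \<Rightarrow> 'a pltl set \<Rightarrow> 'a set \<Rightarrow> 'a pltl set \<Rightarrow> bool" where
  "tableau_step N a \<sigma> a' \<longleftrightarrow>
     (\<forall>\<chi>\<in>a. future_ok N a \<sigma> a' \<chi>) \<and> (\<forall>\<chi>\<in>a'. past_ok a a' \<chi>)"

text \<open>All constraints are implications, so a tableau run may claim fewer formulae than are true.
  From time \<open>j\<close> on, the formulae in \<open>N\<close> may be claimed without justification.\<close>

definition tableau_run ::
    "'a set word \<Rightarrow> 'a pltl set \<Rightarrow> nat \<Rightarrow> (nat \<Rightarrow> 'a pltl set) \<Rightarrow> bool" where
  "tableau_run w N j b \<longleftrightarrow>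
     (\<forall>\<chi>\<in>b 0. init_ok (b 0) \<chi>) \<and>
     (\<forall>s. tableau_step (if s < j then {} else N) (b s) (w s) (b (Suc s)))"

text \<open>Local constraints can fail to give truth in two ways only: an eventuality is postponed
  forever, or a formula in \<open>N\<close> is assumed from \<open>j\<close> on. The hypotheses
  exclude both, and only for nodes of \<open>\<chi>\<close>, so that they can later be supplied by
  induction on size.\<close>

lemma tableau_run_sound:
  assumes run: "tableau_run w N j b"
    and mu: "\<And>\<chi>' t. \<chi>' \<in> set (nodes \<chi>) \<Longrightarrow> is_mu \<chi>' \<Longrightarrow> \<forall>s\<ge>t. \<chi>' \<in> b s \<Longrightarrow> \<exists>r\<ge>t. sat w r \<chi>'"
    and nu: "\<And>\<chi>' t. \<chi>' \<in> set (nodes \<chi>) \<Longrightarrow> is_nu \<chi>' \<Longrightarrow> \<chi>' \<in> N \<Longrightarrow> j \<le> t \<Longrightarrow> sat w t \<chi>'"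
    and "holds (b t) \<chi>"
  shows "sat w t \<chi>"
proof -
  have fut: "future_ok (if s < j then {} else N) (b s) (w s) (b (Suc s)) \<theta>" if "\<theta> \<in> b s" for s \<theta>
    using run that by (auto simp: tableau_run_def tableau_step_def)
  have past: "past_ok (b s) (b (Suc s)) \<theta>" if "\<theta> \<in> b (Suc s)" for s \<theta>
    using run that by (auto simp: tableau_run_def tableau_step_def)
  have ini: "init_ok (b 0) \<theta>" if "\<theta> \<in> b 0" for \<theta>
    using run that by (auto simp: tableau_run_def)
  show ?thesis
    using mu nu \<open>holds (b t) \<chi>\<close>
  proof (induction \<chi> arbitrary: t)
    case (Prop p)
    then show ?case using fut[of "Prop p" t] by auto
  next
    case (NProp p)
    then show ?case using fut[of "NProp p" t] by auto
  next
    case (And \<psi> \<xi>)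
    then show ?case by auto
  next
    case (Or \<psi> \<xi>)
    from Or.prems(3) consider "holds (b t) \<psi>" | "holds (b t) \<xi>" by auto
    then show ?case
    proof cases
      case 1
      then have "sat w t \<psi>" using Or.prems(1,2) by (intro Or.IH(1)) auto
      then show ?thesis by simp
    next
      case 2
      then have "sat w t \<xi>" using Or.prems(1,2) by (intro Or.IH(2)) auto
      then show ?thesis by simp
    qed
  next
    case (Next \<psi>)
    have "holds (b (Suc t)) \<psi>" using fut[of "Next \<psi>" t] Next.prems(3) by simp
    then have "sat w (Suc t) \<psi>" using Next.prems(1,2) by (intro Next.IH) auto
    then show ?case by simp
  next
    case (Until \<psi> \<xi>)
    have IH: "holds (b s) \<psi> \<Longrightarrow> sat w s \<psi>" "holds (b s) \<xi> \<Longrightarrow> sat w s \<xi>" for s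
      using Until.IH Until.prems(1,2) by auto
    \<comment> \<open>If the whole eventuality is true at some later point, then
      \<open>\<xi>\<close> is true there or later still, so the claim cannot persist
      unfulfilled.\<close>
    have fair: "\<exists>r\<ge>t. sat w r \<xi>" if "\<forall>s\<ge>t. Until \<psi> \<xi> \<in> b s"
    proof -
      have "\<exists>r\<ge>t. sat w r (Until \<psi> \<xi>)"
        by (rule Until.prems(1)) (use that in auto)
      then show ?thesis by (auto simp: until_at_def intro: le_trans)
    qed
    show ?case unfolding sat.simps
      by (rule until_at_of_invariant[where R = "\<lambda>s. Until \<psi> \<xi> \<in> b s"])
        (use fut[of "Until \<psi> \<xi>"] IH fair Until.prems(3) in auto)
  next
    case (MRelease \<psi> \<xi>)
    have IH: "holds (b s) \<psi> \<Longrightarrow> sat w s \<psi>" "holds (b s) \<xi> \<Longrightarrow> sat w s \<xi>" for s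
      using MRelease.IH MRelease.prems(1,2) by auto
    have fair: "\<exists>r\<ge>t. sat w r \<psi> \<and> sat w r \<xi>" if "\<forall>s\<ge>t. MRelease \<psi> \<xi> \<in> b s"
    proof -
      have "\<exists>r\<ge>t. sat w r (MRelease \<psi> \<xi>)"
        by (rule MRelease.prems(1)) (use that in auto)
      then show ?thesis by (auto simp: until_at_def intro: le_trans)
    qed
    show ?case unfolding sat.simps
      by (rule until_at_of_invariant[where R = "\<lambda>s. MRelease \<psi> \<xi> \<in> b s"])
        (use fut[of "MRelease \<psi> \<xi>"] IH fair MRelease.prems(3) in auto)
  next
    case (WUntil \<psi> \<xi>)
    have IH: "holds (b s) \<psi> \<Longrightarrow> sat w s \<psi>" "holds (b s) \<xi> \<Longrightarrow> sat w s \<xi>" for s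
      using WUntil.IH WUntil.prems(1,2) by auto
    have nu: "sat w s (WUntil \<psi> \<xi>)" if "WUntil \<psi> \<xi> \<in> N" "j \<le> s" for s
      using WUntil.prems(2)[of "WUntil \<psi> \<xi>"] that by auto
    show ?case unfolding sat.simps
    proof (rule weak_until_at_of_invariant[where R = "\<lambda>s. WUntil \<psi> \<xi> \<in> b s"])
      fix s assume "WUntil \<psi> \<xi> \<in> b s"
      from fut[OF this] show "weak_until_at (\<lambda>s. sat w s \<psi>) (\<lambda>s. sat w s \<xi>) s \<or>
          sat w s \<psi> \<and> WUntil \<psi> \<xi> \<in> b (Suc s)"
        using IH nu[of s] weak_until_at_unfold[of _ _ s] by (auto split: if_splits)
    qed (use WUntil.prems(3) in simp)
  next
    case (Release \<psi> \<xi>)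
    have IH: "holds (b s) \<psi> \<Longrightarrow> sat w s \<psi>" "holds (b s) \<xi> \<Longrightarrow> sat w s \<xi>" for s
      using Release.IH Release.prems(1,2) by auto
    have nu: "sat w s (Release \<psi> \<xi>)" if "Release \<psi> \<xi> \<in> N" "j \<le> s" for s
      using Release.prems(2)[of "Release \<psi> \<xi>"] that by auto
    show ?case unfolding sat.simps
    proof (rule weak_until_at_of_invariant[where R = "\<lambda>s. Release \<psi> \<xi> \<in> b s"])
      fix s assume "Release \<psi> \<xi> \<in> b s"
      from fut[OF this]
      show "weak_until_at (\<lambda>s. sat w s \<xi>) (\<lambda>s. sat w s \<psi> \<and> sat w s \<xi>) s \<or>
          sat w s \<xi> \<and> Release \<psi> \<xi> \<in> b (Suc s)"
        using IH nu[of s] weak_until_at_unfold[of _ _ s] by (auto split: if_splits)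
    qed (use Release.prems(3) in simp)
  next
    case (Prev \<psi>)
    have "t > 0" using ini[of "Prev \<psi>"] Prev.prems(3) by (cases t) auto
    then have "holds (b (t - 1)) \<psi>" using past[of "Prev \<psi>" "t - 1"] Prev.prems(3) by simp
    then have "sat w (t - 1) \<psi>" using Prev.prems(1,2) by (intro Prev.IH) auto
    then show ?case using \<open>t > 0\<close> by simp
  next
    case (WPrev \<psi>)
    show ?case
    proof (cases "t = 0")
      case False
      then have "holds (b (t - 1)) \<psi>" using past[of "WPrev \<psi>" "t - 1"] WPrev.prems(3) by simp
      then have "sat w (t - 1) \<psi>" using WPrev.prems(1,2) by (intro WPrev.IH) auto
      then show ?thesis by simp
    qed simp
  next
    case (Since \<psi> \<xi>)
    have IH: "holds (b s) \<psi> \<Longrightarrow> sat w s \<psi>" "holds (b s) \<xi> \<Longrightarrow> sat w s \<xi>" for s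
      using Since.IH Since.prems(1,2) by auto
    \<comment> \<open>Past claims are traced back to time 0, where \<open>init_ok\<close> ends every
      chain; the inner induction is on time.\<close>
    have "Since \<psi> \<xi> \<in> b t" using Since.prems(3) by simp
    then show ?case
      by (induction t) (use IH past[of "Since \<psi> \<xi>"] ini[of "Since \<psi> \<xi>"] in auto)
  next
    case (WSince \<psi> \<xi>)
    have IH: "holds (b s) \<psi> \<Longrightarrow> sat w s \<psi>" "holds (b s) \<xi> \<Longrightarrow> sat w s \<xi>" for s
      using WSince.IH WSince.prems(1,2) by auto
    have "WSince \<psi> \<xi> \<in> b t" using WSince.prems(3) by simp
    then show ?case
      by (induction t) (use IH past[of "WSince \<psi> \<xi>"] ini[of "WSince \<psi> \<xi>"] in auto)
  next
    case (Before \<psi> \<xi>)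
    have IH: "holds (b s) \<psi> \<Longrightarrow> sat w s \<psi>" "holds (b s) \<xi> \<Longrightarrow> sat w s \<xi>" for s
      using Before.IH Before.prems(1,2) by auto
    have "Before \<psi> \<xi> \<in> b t" using Before.prems(3) by simp
    then show ?case
      by (induction t) (use IH past[of "Before \<psi> \<xi>"] ini[of "Before \<psi> \<xi>"] in auto)
  next
    case (WBefore \<psi> \<xi>)
    have IH: "holds (b s) \<psi> \<Longrightarrow> sat w s \<psi>" "holds (b s) \<xi> \<Longrightarrow> sat w s \<xi>" for s
      using WBefore.IH WBefore.prems(1,2) by auto
    have "WBefore \<psi> \<xi> \<in> b t" using WBefore.prems(3) by simp
    then show ?case
      by (induction t) (use IH past[of "WBefore \<psi> \<xi>"] ini[of "WBefore \<psi> \<xi>"] in auto)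
  qed auto
qed

text \<open>The best finite tableau run on \<open>{..k}\<close> that discharges \<open>N\<close> from time \<open>j\<close> on: every
  eventuality has to be fulfilled by time \<open>k\<close>.\<close>

primrec approx ::
    "'a set word \<Rightarrow> 'a pltl set \<Rightarrow> nat \<Rightarrow> nat \<Rightarrow> nat \<Rightarrow> 'a pltl \<Rightarrow> bool" where
  "approx w N j k t Top \<longleftrightarrow> True"
| "approx w N j k t Bot \<longleftrightarrow> False"
| "approx w N j k t (Prop p) \<longleftrightarrow> p \<in> w t"
| "approx w N j k t (NProp p) \<longleftrightarrow> p \<notin> w t"
| "approx w N j k t (And \<psi> \<xi>) \<longleftrightarrow> approx w N j k t \<psi> \<and> approx w N j k t \<xi>"
| "approx w N j k t (Or \<psi> \<xi>) \<longleftrightarrow> approx w N j k t \<psi> \<or> approx w N j k t \<xi>"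
| "approx w N j k t (Next \<psi>) \<longleftrightarrow> t < k \<and> approx w N j k (Suc t) \<psi>"
| "approx w N j k t (Until \<psi> \<xi>) \<longleftrightarrow>
     until_at (\<lambda>s. approx w N j k s \<psi>) (\<lambda>s. s \<le> k \<and> approx w N j k s \<xi>) t"
| "approx w N j k t (WUntil \<psi> \<xi>) \<longleftrightarrow>
     until_at (\<lambda>s. approx w N j k s \<psi>)
       (\<lambda>s. s \<le> k \<and> (approx w N j k s \<xi> \<or> WUntil \<psi> \<xi> \<in> N \<and> j \<le> s)) t"
| "approx w N j k t (Release \<psi> \<xi>) \<longleftrightarrow>
     until_at (\<lambda>s. approx w N j k s \<xi>)
       (\<lambda>s. s \<le> k \<and> (approx w N j k s \<psi> \<and> approx w N j k s \<xi> \<or> Release \<psi> \<xi> \<in> N \<and> j \<le> s)) t"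
| "approx w N j k t (MRelease \<psi> \<xi>) \<longleftrightarrow>
     until_at (\<lambda>s. approx w N j k s \<xi>)
       (\<lambda>s. s \<le> k \<and> approx w N j k s \<psi> \<and> approx w N j k s \<xi>) t"
| "approx w N j k t (Prev \<psi>) \<longleftrightarrow> t > 0 \<and> approx w N j k (t - 1) \<psi>"
| "approx w N j k t (WPrev \<psi>) \<longleftrightarrow> t = 0 \<or> approx w N j k (t - 1) \<psi>"
| "approx w N j k t (Since \<psi> \<xi>) \<longleftrightarrow>
     since_at (\<lambda>s. approx w N j k s \<psi>) (\<lambda>s. approx w N j k s \<xi>) t"
| "approx w N j k t (WSince \<psi> \<xi>) \<longleftrightarrow>
     weak_since_at (\<lambda>s. approx w N j k s \<psi>) (\<lambda>s. approx w N j k s \<xi>) t"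
| "approx w N j k t (Before \<psi> \<xi>) \<longleftrightarrow>
     since_at (\<lambda>s. approx w N j k s \<xi>) (\<lambda>s. approx w N j k s \<psi> \<and> approx w N j k s \<xi>) t"
| "approx w N j k t (WBefore \<psi> \<xi>) \<longleftrightarrow>
     weak_since_at (\<lambda>s. approx w N j k s \<xi>) (\<lambda>s. approx w N j k s \<psi> \<and> approx w N j k s \<xi>) t"

section \<open>Convergence of the finite approximations\<close>

text \<open>A witness \<open>r\<close> involves \<open>P\<close> at finitely many points and
  \<open>Q\<close> at one, so finitely many eventual properties are combined, together with
  \<open>r \<le> k\<close>.\<close>

lemma eventually_until_at:
  assumes "until_at P Q t"
    and "\<And>s. P s \<Longrightarrow> \<forall>\<^sub>F k in sequentially. P' k s"
    and "\<And>s. Q s \<Longrightarrow> \<forall>\<^sub>F k in sequentially. Q' k s"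
  shows "\<forall>\<^sub>F k in sequentially. until_at (P' k) (\<lambda>s. s \<le> k \<and> Q' k s) t"
proof -
  obtain r where r: "r \<ge> t" "Q r" "\<forall>s\<in>{t..<r}. P s"
    using assms(1) unfolding until_at_def by blast
  have "\<forall>\<^sub>F k in sequentially. \<forall>s\<in>{t..<r}. P' k s"
    using r(3) assms(2) by (intro eventually_ball_finite) auto
  moreover have "\<forall>\<^sub>F k in sequentially. Q' k r"
    using r(2) assms(3) by blast
  moreover have "\<forall>\<^sub>F k in sequentially. r \<le> k"
    by (rule eventually_ge_at_top)
  ultimately show ?thesis
    by eventually_elim (use r(1) in \<open>auto simp: until_at_def\<close>)
qed

lemma eventually_since_at:
  assumes "since_at P Q t"
    and "\<And>s. P s \<Longrightarrow> \<forall>\<^sub>F k in sequentially. P' k s"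
    and "\<And>s. Q s \<Longrightarrow> \<forall>\<^sub>F k in sequentially. Q' k s"
  shows "\<forall>\<^sub>F k in sequentially. since_at (P' k) (Q' k) t"
proof -
  obtain r where r: "r \<le> t" "Q r" "\<forall>s\<in>{r<..t}. P s"
    using assms(1) unfolding since_at_def by blast
  have "\<forall>\<^sub>F k in sequentially. \<forall>s\<in>{r<..t}. P' k s"
    using r(3) assms(2) by (intro eventually_ball_finite) auto
  moreover have "\<forall>\<^sub>F k in sequentially. Q' k r"
    using r(2) assms(3) by blast
  ultimately show ?thesis
    by eventually_elim (use r(1) in \<open>auto simp: since_at_def\<close>)
qed

text \<open>The past is finite, so even the case where \<open>P\<close> holds on all of
  \<open>{..t}\<close> is a finite conjunction.\<close>

lemma eventually_weak_since_at:
  assumes "weak_since_at P Q t"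
    and "\<And>s. P s \<Longrightarrow> \<forall>\<^sub>F k in sequentially. P' k s"
    and "\<And>s. Q s \<Longrightarrow> \<forall>\<^sub>F k in sequentially. Q' k s"
  shows "\<forall>\<^sub>F k in sequentially. weak_since_at (P' k) (Q' k) t"
proof (cases "since_at P Q t")
  case True
  then have "\<forall>\<^sub>F k in sequentially. since_at (P' k) (Q' k) t"
    using assms(2,3) by (rule eventually_since_at)
  then show ?thesis
    by eventually_elim (simp add: weak_since_at_def)
next
  case False
  then have "\<forall>s\<in>{..t}. P s" using assms(1) by (simp add: weak_since_at_def)
  then have "\<forall>\<^sub>F k in sequentially. \<forall>s\<in>{..t}. P' k s"
    using assms(2) by (intro eventually_ball_finite) auto
  then show ?thesis
    by eventually_elim (simp add: weak_since_at_def)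
qed

text \<open>Without a witness for \<open>Q\<close>, \<open>P\<close> holds forever, so the weak
  until holds at all later points and \<open>C\<close> follows; \<open>max t j\<close> is then a
  point of discharge. In its uses, \<open>C\<close> is membership in \<open>N\<close>.\<close>

lemma weak_until_at_discharge:
  assumes "weak_until_at P Q t" and "(\<forall>s\<ge>t. weak_until_at P Q s) \<Longrightarrow> C"
  shows "until_at P (\<lambda>s. Q s \<or> C \<and> j \<le> s) t"
proof (cases "until_at P Q t")
  case True
  then show ?thesis unfolding until_at_def by blast
next
  case False
  with assms(1) have P: "\<forall>s\<ge>t. P s" by (simp add: weak_until_at_def)
  then have "\<forall>s\<ge>t. weak_until_at P Q s" by (auto simp: weak_until_at_def)
  with assms(2) have C by blast
  with P show ?thesis
    by (auto simp: until_at_def intro!: exI[of _ "max t j"])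
qed

text \<open>\<open>N\<close> contains every greatest-fixpoint node of \<open>\<chi>\<close> that
  holds from some point on. A true weak operator thus becomes a strong until that may end in a
  discharge, so truth has a finite justification, which a large \<open>k\<close> covers.\<close>

lemma eventually_approx:
  assumes "\<And>\<chi>'. \<chi>' \<in> set (nodes \<chi>) \<Longrightarrow> is_nu \<chi>' \<Longrightarrow> \<exists>i. \<forall>t\<ge>i. sat w t \<chi>' \<Longrightarrow> \<chi>' \<in> N"
    and "sat w t \<chi>"
  shows "\<forall>\<^sub>F k in sequentially. approx w N j k t \<chi>"
  using assms
proof (induction \<chi> arbitrary: t)
  case (And \<psi> \<xi>)
  then show ?case by (auto intro!: eventually_conj)
next
  case (Or \<psi> \<xi>)
  from Or.prems(2) consider "sat w t \<psi>" | "sat w t \<xi>" by auto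
  then show ?case
  proof cases
    case 1
    then have "\<forall>\<^sub>F k in sequentially. approx w N j k t \<psi>"
      using Or.prems(1) by (intro Or.IH(1)) auto
    then show ?thesis by eventually_elim simp
  next
    case 2
    then have "\<forall>\<^sub>F k in sequentially. approx w N j k t \<xi>"
      using Or.prems(1) by (intro Or.IH(2)) auto
    then show ?thesis by eventually_elim simp
  qed
next
  case (Next \<psi>)
  have "\<forall>\<^sub>F k in sequentially. approx w N j k (Suc t) \<psi>"
    using Next.prems by (intro Next.IH) auto
  moreover have "\<forall>\<^sub>F k in sequentially. t < k" by (rule eventually_gt_at_top)
  ultimately show ?case by eventually_elim simp
next
  case (Until \<psi> \<xi>)
  show ?case unfolding approx.simps
    by (rule eventually_until_at[OF Until.prems(2)[unfolded sat.simps]])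
      (use Until.IH Until.prems(1) in auto)
next
  case (MRelease \<psi> \<xi>)
  show ?case unfolding approx.simps
    by (rule eventually_until_at[OF MRelease.prems(2)[unfolded sat.simps]])
      (use MRelease.IH MRelease.prems(1) in \<open>auto intro!: eventually_conj\<close>)
next
  case (WUntil \<psi> \<xi>)
  have U: "until_at (\<lambda>s. sat w s \<psi>) (\<lambda>s. sat w s \<xi> \<or> WUntil \<psi> \<xi> \<in> N \<and> j \<le> s) t"
    using WUntil.prems(2) WUntil.prems(1)[of "WUntil \<psi> \<xi>"]
    by (intro weak_until_at_discharge) auto
  show ?case unfolding approx.simps
    by (rule eventually_until_at[OF U])
      (use WUntil.IH WUntil.prems(1) in \<open>auto elim!: eventually_mono\<close>)
next
  case (Release \<psi> \<xi>)
  have U: "until_at (\<lambda>s. sat w s \<xi>)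
      (\<lambda>s. sat w s \<psi> \<and> sat w s \<xi> \<or> Release \<psi> \<xi> \<in> N \<and> j \<le> s) t"
    using Release.prems(2) Release.prems(1)[of "Release \<psi> \<xi>"]
    by (intro weak_until_at_discharge) auto
  have IH: "sat w s \<psi> \<Longrightarrow> \<forall>\<^sub>F k in sequentially. approx w N j k s \<psi>"
    "sat w s \<xi> \<Longrightarrow> \<forall>\<^sub>F k in sequentially. approx w N j k s \<xi>" for s
    using Release.IH Release.prems(1) by auto
  show ?case unfolding approx.simps
  proof (rule eventually_until_at[OF U])
    fix s assume "sat w s \<psi> \<and> sat w s \<xi> \<or> Release \<psi> \<xi> \<in> N \<and> j \<le> s"
    then show "\<forall>\<^sub>F k in sequentially.
        approx w N j k s \<psi> \<and> approx w N j k s \<xi> \<or> Release \<psi> \<xi> \<in> N \<and> j \<le> s"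
    proof
      assume "sat w s \<psi> \<and> sat w s \<xi>"
      then have "\<forall>\<^sub>F k in sequentially. approx w N j k s \<psi> \<and> approx w N j k s \<xi>"
        using IH by (intro eventually_conj) auto
      then show ?thesis by eventually_elim simp
    qed simp
  qed (use IH in auto)
next
  case (Prev \<psi>)
  then have "\<forall>\<^sub>F k in sequentially. approx w N j k (t - 1) \<psi>"
    by (intro Prev.IH) auto
  then show ?case by eventually_elim (use Prev.prems(2) in simp)
next
  case (WPrev \<psi>)
  show ?case
  proof (cases "t = 0")
    case False
    with WPrev.prems have "\<forall>\<^sub>F k in sequentially. approx w N j k (t - 1) \<psi>"
      by (intro WPrev.IH) auto
    then show ?thesis by eventually_elim simp
  qed simp
next
  case (Since \<psi> \<xi>)
  show ?case unfolding approx.simps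
    by (rule eventually_since_at[OF Since.prems(2)[unfolded sat.simps]])
      (use Since.IH Since.prems(1) in auto)
next
  case (WSince \<psi> \<xi>)
  show ?case unfolding approx.simps
    by (rule eventually_weak_since_at[OF WSince.prems(2)[unfolded sat.simps]])
      (use WSince.IH WSince.prems(1) in auto)
next
  case (Before \<psi> \<xi>)
  show ?case unfolding approx.simps
    by (rule eventually_since_at[OF Before.prems(2)[unfolded sat.simps]])
      (use Before.IH Before.prems(1) in \<open>auto intro!: eventually_conj\<close>)
next
  case (WBefore \<psi> \<xi>)
  show ?case unfolding approx.simps
    by (rule eventually_weak_since_at[OF WBefore.prems(2)[unfolded sat.simps]])
      (use WBefore.IH WBefore.prems(1) in \<open>auto intro!: eventually_conj\<close>)
qed auto

text \<open>Boolean nodes do not count towards the size of \<open>\<phi>\<close>, so atoms may not contain them.\<close>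

definition basis :: "'a pltl \<Rightarrow> 'a pltl set" where
  "basis \<phi> = {\<chi> \<in> set (nodes \<phi>). is_future \<chi> \<or> is_propositional \<chi> \<or> is_past \<chi>}"

section \<open>Canonical tableau runs\<close>

lemma holds_sat:
  "set (nodes \<chi>) \<subseteq> set (nodes \<phi>) \<Longrightarrow> holds {\<theta> \<in> basis \<phi>. sat w t \<theta>} \<chi> \<longleftrightarrow> sat w t \<chi>"
  by (induction \<chi>) (auto simp: basis_def)

lemma holds_approx:
  "set (nodes \<chi>) \<subseteq> set (nodes \<phi>) \<Longrightarrow> t \<le> k \<Longrightarrow>
    holds {\<theta> \<in> basis \<phi>. t \<le> k \<and> approx w N j k t \<theta>} \<chi> \<longleftrightarrow> approx w N j k t \<chi>"
  by (induction \<chi>) (auto simp: basis_def)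

lemma tableau_run_sat: "tableau_run w {} 0 (\<lambda>t. {\<theta> \<in> basis \<phi>. sat w t \<theta>})"
proof -
  let ?b = "\<lambda>t. {\<theta> \<in> basis \<phi>. sat w t \<theta>}"
  have sub: "set (nodes \<theta>) \<subseteq> set (nodes \<phi>)" if "\<theta> \<in> basis \<phi>" for \<theta>
    using that nodes_trans[of \<theta> \<phi>] by (auto simp: basis_def)
  have "init_ok (?b 0) \<theta>" if "\<theta> \<in> ?b 0" for \<theta>
    using that sub[of \<theta>] by (cases \<theta>) (auto simp: holds_sat)
  moreover have "future_ok {} (?b t) (w t) (?b (Suc t)) \<theta>" if "\<theta> \<in> ?b t" for \<theta> t
    using that sub[of \<theta>]
    by (cases \<theta>) (auto simp: holds_sat until_at_unfold[of _ _ t] weak_until_at_unfold[of _ _ t])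
  moreover have "past_ok (?b t) (?b (Suc t)) \<theta>" if "\<theta> \<in> ?b (Suc t)" for \<theta> t
    using that sub[of \<theta>]
    by (cases \<theta>) (auto simp: holds_sat)
  ultimately show ?thesis
    by (auto simp: tableau_run_def tableau_step_def)
qed

lemma until_at_bounded: "until_at P (\<lambda>s. s \<le> k \<and> Q s) t \<Longrightarrow> t \<le> (k::nat)"
  by (auto simp: until_at_def)

text \<open>Nothing is pending after \<open>k\<close>: every until in \<open>approx\<close> has its
  witness at most at \<open>k\<close>, and \<open>Next\<close> demands \<open>t < k\<close>. Hence
  the empty atoms from \<open>Suc k\<close> on break no constraint.\<close>

lemma tableau_run_approx:
  "tableau_run w N j (\<lambda>t. {\<theta> \<in> basis \<phi>. t \<le> k \<and> approx w N j k t \<theta>})"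
proof -
  define b where "b = (\<lambda>t. {\<theta> \<in> basis \<phi>. t \<le> k \<and> approx w N j k t \<theta>})"
  have mem: "\<theta> \<in> b t \<longleftrightarrow> \<theta> \<in> basis \<phi> \<and> t \<le> k \<and> approx w N j k t \<theta>" for t \<theta>
    by (simp add: b_def)
  have hold: "holds (b t) \<theta> \<longleftrightarrow> approx w N j k t \<theta>"
    if "set (nodes \<theta>) \<subseteq> set (nodes \<phi>)" "t \<le> k" for t \<theta>
    unfolding b_def using that by (rule holds_approx)
  have sub: "set (nodes \<theta>) \<subseteq> set (nodes \<phi>)" if "\<theta> \<in> basis \<phi>" for \<theta>
    using that nodes_trans[of \<theta> \<phi>] by (auto simp: basis_def)
  have "init_ok (b 0) \<theta>" if "\<theta> \<in> b 0" for \<theta>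
    using that sub[of \<theta>] by (cases \<theta>) (auto simp: hold mem)
  moreover have "future_ok (if t < j then {} else N) (b t) (w t) (b (Suc t)) \<theta>"
    if "\<theta> \<in> b t" for \<theta> t
    using that sub[of \<theta>]
    by (cases \<theta>) (auto simp: hold mem until_at_unfold[of _ _ t] dest: until_at_bounded)
  moreover have "past_ok (b t) (b (Suc t)) \<theta>" if "\<theta> \<in> b (Suc t)" for \<theta> t
    using that sub[of \<theta>] by (cases \<theta>) (auto simp: hold mem)
  ultimately show ?thesis
    unfolding b_def[symmetric] by (auto simp: tableau_run_def tableau_step_def)
qed

section \<open>Certificates for a guess of the limit behaviour\<close>

definition mu_part :: "'a pltl set \<Rightarrow> 'a pltl set" where
  "mu_part X = {\<chi> \<in> X. is_mu \<chi>}"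

definition nu_part :: "'a pltl set \<Rightarrow> 'a pltl set" where
  "nu_part X = {\<chi> \<in> X. is_nu \<chi>}"

definition fixpoint_nodes :: "'a pltl \<Rightarrow> 'a pltl set" where
  "fixpoint_nodes \<phi> = {\<chi> \<in> set (nodes \<phi>). is_mu \<chi> \<or> is_nu \<chi>}"

definition settled :: "'a pltl set \<Rightarrow> 'a pltl set set" where
  "settled X = {a. nu_part X \<subseteq> a \<and> (\<forall>\<chi>\<in>a. is_mu \<chi> \<longrightarrow> \<chi> \<in> X)}"

definition settling_run :: "'a pltl \<Rightarrow> 'a set word \<Rightarrow> 'a pltl set \<Rightarrow> bool" where
  "settling_run \<phi> w X \<longleftrightarrow>
     (\<exists>b i. tableau_run w {} 0 b \<and> holds (b 0) \<phi> \<and> (\<forall>t. b t \<subseteq> basis \<phi>) \<and>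
        (\<forall>t\<ge>i. b t \<in> settled X))"

text \<open>A finite run is padded with empty atoms. An empty atom claims nothing, so no eventuality
  is still pending at \<open>k\<close>.\<close>

definition fulfilling_run :: "'a pltl \<Rightarrow> 'a set word \<Rightarrow> 'a pltl set \<Rightarrow> nat \<Rightarrow> bool" where
  "fulfilling_run \<phi> w X j \<longleftrightarrow>
     (\<exists>b k. tableau_run w (nu_part X) j b \<and> holds (b 0) \<phi> \<and> (\<forall>t. b t \<subseteq> basis \<phi>) \<and>
        (\<forall>t\<ge>k. b t = {}) \<and> (\<forall>\<chi>\<in>mu_part X. \<exists>t\<ge>j. \<chi> \<in> b t))"

text \<open>A least-fixpoint node of \<open>X\<close> recurs because a fulfilling run can be started
  after all smaller greatest-fixpoint nodes of \<open>X\<close> have become permanent. A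
  greatest-fixpoint node of \<open>X\<close> is claimed forever by the settling run, and the
  eventualities below it that are claimed forever lie in \<open>X\<close> and are smaller.\<close>

lemma certificate_sound:
  assumes X: "X \<subseteq> fixpoint_nodes \<phi>"
    and "settling_run \<phi> w X"
    and fulfil: "\<And>i. \<exists>j\<ge>i. fulfilling_run \<phi> w X j"
  shows "sat w 0 \<phi>"
proof -
  obtain a i where a: "tableau_run w {} 0 a" "holds (a 0) \<phi>" "\<forall>t\<ge>i. a t \<in> settled X"
    using assms(2) unfolding settling_run_def by blast
  have "finite X"
    using X by (rule finite_subset) (simp add: fixpoint_nodes_def)
  \<comment> \<open>A formula claimed from \<open>t\<close> on is claimed in some settled
    atom.\<close>
  have mu_a: "\<chi> \<in> X" if "is_mu \<chi>" "\<forall>s\<ge>t. \<chi> \<in> a s" for \<chi> t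
    using that a(3) unfolding settled_def
    by (metis (no_types, lifting) linorder_linear mem_Collect_eq order_refl)
  have key: "(is_mu \<chi> \<longrightarrow> (\<forall>j. \<exists>t\<ge>j. sat w t \<chi>)) \<and> (is_nu \<chi> \<longrightarrow> (\<exists>j. \<forall>t\<ge>j. sat w t \<chi>))"
    if "\<chi> \<in> X" for \<chi>
    using that
  proof (induction "size \<chi>" arbitrary: \<chi> rule: less_induct)
    case less
    show ?case
    proof (intro conjI impI allI)
      fix j0
      assume mu: "is_mu \<chi>"
      \<comment> \<open>\<open>X\<close> is finite, so the thresholds from the induction hypothesis
        have a common bound.\<close>
      have "\<forall>\<^sub>F j in sequentially.
          \<forall>\<theta>\<in>{\<theta> \<in> X. is_nu \<theta> \<and> size \<theta> < size \<chi>}. \<forall>t\<ge>j. sat w t \<theta>"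
        using less.hyps \<open>finite X\<close>
        by (intro eventually_ball_finite)
          (auto simp: eventually_sequentially, meson order_trans)
      then obtain i0 where i0: "\<And>j \<theta> t. j \<ge> i0 \<Longrightarrow> \<theta> \<in> X \<Longrightarrow> is_nu \<theta> \<Longrightarrow>
          size \<theta> < size \<chi> \<Longrightarrow> t \<ge> j \<Longrightarrow> sat w t \<theta>"
        by (auto simp: eventually_sequentially)
      obtain j where j: "j \<ge> max i0 j0" "fulfilling_run \<phi> w X j"
        using fulfil by blast
      then obtain b k where b: "tableau_run w (nu_part X) j b" "\<forall>t\<ge>k. b t = {}"
        "\<forall>\<chi>\<in>mu_part X. \<exists>t\<ge>j. \<chi> \<in> b t"
        unfolding fulfilling_run_def by blast
      obtain t where t: "t \<ge> j" "\<chi> \<in> b t"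
        using b(3) mu less.prems by (auto simp: mu_part_def)
      have "sat w t \<chi>"
      proof (rule tableau_run_sound[OF b(1)])
        \<comment> \<open>Vacuous: \<open>b\<close> is empty from \<open>k\<close> on and claims
          nothing forever.\<close>
        show "\<exists>r\<ge>t. sat w r \<theta>" if "\<forall>s\<ge>t. \<theta> \<in> b s" for \<theta> t
          using that b(2) by (metis empty_iff linorder_linear)
        show "sat w t \<theta>"
          if "\<theta> \<in> set (nodes \<chi>)" "is_nu \<theta>" "\<theta> \<in> nu_part X" "j \<le> t" for \<theta> t
        proof -
          \<comment> \<open>\<open>\<theta>\<close> is of the other fixpoint kind, hence a proper
            subformula of \<open>\<chi>\<close>.\<close>
          have "size \<theta> < size \<chi>"
            using size_nodes[OF that(1)] mu that(2) is_nu_not_is_mu by blast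
          then show ?thesis
            using that j(1) by (intro i0[of j]) (auto simp: nu_part_def)
        qed
        show "holds (b t) \<chi>" using t(2) mu by (cases \<chi>) auto
      qed
      then show "\<exists>t\<ge>j0. sat w t \<chi>" using t(1) j(1) by (intro exI[of _ t]) auto
    next
      assume nu: "is_nu \<chi>"
      have "sat w t \<chi>" if "t \<ge> i" for t
      proof (rule tableau_run_sound[OF a(1)])
        show "\<exists>r\<ge>t. sat w r \<theta>"
          if "\<theta> \<in> set (nodes \<chi>)" "is_mu \<theta>" "\<forall>s\<ge>t. \<theta> \<in> a s" for \<theta> t
        proof -
          have "size \<theta> < size \<chi>"
            using size_nodes[OF that(1)] nu that(2) is_nu_not_is_mu by blast
          then show ?thesis
            using less.hyps[of \<theta>] mu_a that by blast
        qed
        have "\<chi> \<in> a t"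
          using a(3) that nu less.prems by (auto simp: settled_def nu_part_def)
        then show "holds (a t) \<chi>" using nu by (cases \<chi>) auto
      qed auto
      then show "\<exists>j. \<forall>t\<ge>j. sat w t \<chi>" by blast
    qed
  qed
  show ?thesis
    by (rule tableau_run_sound[OF a(1)]) (use a(2) mu_a key in \<open>blast+\<close>)
qed

text \<open>The sets of true formulas form a settling run, and the finite approximations for large
  \<open>k\<close> form fulfilling runs.\<close>

lemma certificate_complete:
  assumes "sat w 0 \<phi>"
  obtains X where "X \<subseteq> fixpoint_nodes \<phi>" "settling_run \<phi> w X" "\<And>j. fulfilling_run \<phi> w X j"
proof
  \<comment> \<open>The actual limit behaviour along \<open>w\<close> is the right guess.\<close>
  define X where "X = {\<chi> \<in> set (nodes \<phi>). is_mu \<chi> \<and> (\<forall>j. \<exists>t\<ge>j. sat w t \<chi>) \<or>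
    is_nu \<chi> \<and> (\<exists>i. \<forall>t\<ge>i. sat w t \<chi>)}"
  show "X \<subseteq> fixpoint_nodes \<phi>"
    by (auto simp: X_def fixpoint_nodes_def)
  have "finite X" by (simp add: X_def)
  have muX: "mu_part X = {\<chi> \<in> set (nodes \<phi>). is_mu \<chi> \<and> (\<forall>j. \<exists>t\<ge>j. sat w t \<chi>)}"
    by (auto simp: mu_part_def X_def dest: is_nu_not_is_mu)
  have nuX: "nu_part X = {\<chi> \<in> set (nodes \<phi>). is_nu \<chi> \<and> (\<exists>i. \<forall>t\<ge>i. sat w t \<chi>)}"
    by (auto simp: nu_part_def X_def dest: is_nu_not_is_mu)
  have basis: "\<chi> \<in> basis \<phi>" if "\<chi> \<in> set (nodes \<phi>)" "is_mu \<chi> \<or> is_nu \<chi>" for \<chi>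
    by (cases \<chi>) (use that in \<open>auto simp: basis_def\<close>)
  show "settling_run \<phi> w X"
  proof -
    let ?b = "\<lambda>t. {\<theta> \<in> basis \<phi>. sat w t \<theta>}"
    have "\<forall>\<^sub>F t in sequentially. \<forall>\<chi>\<in>nu_part X. sat w t \<chi>"
      using \<open>finite X\<close> by (intro eventually_ball_finite) (auto simp: nuX eventually_sequentially)
    moreover have "\<forall>\<^sub>F t in sequentially.
        \<forall>\<chi>\<in>{\<chi> \<in> set (nodes \<phi>). is_mu \<chi> \<and> \<chi> \<notin> X}. \<not> sat w t \<chi>"
      by (intro eventually_ball_finite) (auto simp: X_def eventually_sequentially)
    ultimately have "\<forall>\<^sub>F t in sequentially. ?b t \<in> settled X"
    proof eventually_elim
      case (elim t)
      then show ?case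
        using basis by (auto simp: settled_def nuX) (auto simp: basis_def)
    qed
    then obtain i where "\<forall>t\<ge>i. ?b t \<in> settled X"
      by (auto simp: eventually_sequentially)
    then show ?thesis
      unfolding settling_run_def using tableau_run_sat[of w \<phi>] holds_sat[of \<phi> \<phi> w 0] assms
      by (intro exI[of _ ?b] exI[of _ i]) auto
  qed
  show "fulfilling_run \<phi> w X j" for j
  proof -
    have nu: "\<theta> \<in> nu_part X"
      if "\<chi> \<in> set (nodes \<phi>)" "\<theta> \<in> set (nodes \<chi>)" "is_nu \<theta>" "\<exists>i. \<forall>t\<ge>i. sat w t \<theta>" for \<chi> \<theta>
      using nodes_trans[OF that(1)] that by (auto simp: nuX)
    have "\<forall>\<^sub>F k in sequentially. approx w (nu_part X) j k 0 \<phi>"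
      by (rule eventually_approx) (use nu[of \<phi>] assms in auto)
    moreover have "\<forall>\<^sub>F k in sequentially.
        \<forall>\<chi>\<in>mu_part X. \<exists>t\<ge>j. t \<le> k \<and> approx w (nu_part X) j k t \<chi>"
    proof (intro eventually_ball_finite ballI)
      fix \<chi> assume "\<chi> \<in> mu_part X"
      then obtain t where t: "\<chi> \<in> set (nodes \<phi>)" "t \<ge> j" "sat w t \<chi>"
        by (auto simp: muX)
      have "\<forall>\<^sub>F k in sequentially. approx w (nu_part X) j k t \<chi>"
        by (rule eventually_approx) (use nu[of \<chi>] t in auto)
      moreover have "\<forall>\<^sub>F k in sequentially. t \<le> k" by (rule eventually_ge_at_top)
      ultimately show "\<forall>\<^sub>F k in sequentially. \<exists>t\<ge>j. t \<le> k \<and> approx w (nu_part X) j k t \<chi>"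
        by eventually_elim (use t(2) in blast)
    qed (simp add: muX)
    ultimately have "\<forall>\<^sub>F k in sequentially. approx w (nu_part X) j k 0 \<phi> \<and>
        (\<forall>\<chi>\<in>mu_part X. \<exists>t\<ge>j. t \<le> k \<and> approx w (nu_part X) j k t \<chi>)"
      by (rule eventually_conj)
    then obtain k where k: "approx w (nu_part X) j k 0 \<phi>"
      "\<forall>\<chi>\<in>mu_part X. \<exists>t\<ge>j. t \<le> k \<and> approx w (nu_part X) j k t \<chi>"
      by (auto simp: eventually_sequentially)
    let ?b = "\<lambda>t. {\<theta> \<in> basis \<phi>. t \<le> k \<and> approx w (nu_part X) j k t \<theta>}"
    have "\<exists>t\<ge>j. \<chi> \<in> ?b t" if "\<chi> \<in> mu_part X" for \<chi>
      using k(2) that basis[of \<chi>] by (auto simp: muX)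
    \<comment> \<open>The atom at \<open>k\<close> itself may be nonempty, so the empty tail starts
      at \<open>Suc k\<close>.\<close>
    then show ?thesis
      unfolding fulfilling_run_def
      using tableau_run_approx[of w "nu_part X" j \<phi> k] k(1) holds_approx[of \<phi> \<phi> 0 k w "nu_part X" j]
      by (intro exI[of _ ?b] exI[of _ "Suc k"]) auto
  qed
qed

subsection \<open>Determinization\<close>

text \<open>If every \<open>y\<close> failed at some \<open>n\<close>, antitonicity would make each
  failure permanent, and by finiteness of \<open>A\<close> all would fail at a common
  \<open>n\<close>.\<close>

lemma finite_antimono_witness:
  assumes "finite A" and "\<And>n::nat. \<exists>y\<in>A. Q n y" and "\<And>m n y. m \<le> n \<Longrightarrow> Q n y \<Longrightarrow> Q m y"
  shows "\<exists>y\<in>A. \<forall>n. Q n y"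
proof (rule ccontr)
  assume "\<not> ?thesis"
  then have "\<forall>y\<in>A. \<forall>\<^sub>F n in sequentially. \<not> Q n y"
    using assms(3) by (auto simp: eventually_sequentially) blast
  then have "\<forall>\<^sub>F n in sequentially. \<forall>y\<in>A. \<not> Q n y"
    by (rule eventually_ball_finite[OF \<open>finite A\<close>])
  then show False
    using assms(2) by (auto simp: eventually_sequentially)
qed

text \<open>Only predecessors are assumed, so finite paths are built backwards from later layers;
  finiteness of the layers then selects nodes that start arbitrarily long paths.\<close>

lemma koenig_layered:
  assumes fin: "\<And>t. finite (V t)" and ne: "\<And>t. V t \<noteq> {}"
    and pred: "\<And>t y. y \<in> V (Suc t) \<Longrightarrow> \<exists>x\<in>V t. E t x y"
  shows "\<exists>b. \<forall>t. b t \<in> V t \<and> E t (b t) (b (Suc t))"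
proof -
  \<comment> \<open>\<open>D n t x\<close> says that a path with \<open>n\<close> edges starts at
    \<open>x\<close> in layer \<open>t\<close>.\<close>
  define D where "D = rec_nat (\<lambda>t x. x \<in> V t) (\<lambda>n D t x. x \<in> V t \<and> (\<exists>y. E t x y \<and> D (Suc t) y))"
  have D_0: "D 0 t x \<longleftrightarrow> x \<in> V t"
    and D_Suc: "D (Suc n) t x \<longleftrightarrow> x \<in> V t \<and> (\<exists>y. E t x y \<and> D n (Suc t) y)" for n t x
    by (simp_all add: D_def)
  have D_V: "x \<in> V t" if "D n t x" for n t x
    using that by (cases n) (auto simp: D_0 D_Suc)
  have D_step: "D n t x" if "D (Suc n) t x" for n t x
    using that by (induction n arbitrary: t x) (auto simp: D_0 D_Suc)
  have anti: "D m t x" if "m \<le> n" "D n t x" for m n t x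
    using that by (induction m rule: inc_induct) (auto intro: D_step)
  have ex: "\<exists>x. D n t x" for n t
  proof (induction n arbitrary: t)
    case 0
    then show ?case using ne by (auto simp: D_0)
  next
    case (Suc n)
    then obtain y where "D n (Suc t) y" by blast
    then show ?case using pred D_V by (metis D_Suc)
  qed
  have start: "\<exists>x\<in>V 0. \<forall>n. D n 0 x"
    by (rule finite_antimono_witness) (use fin ex anti D_V in blast)+
  have ext: "\<exists>y. (\<forall>n. D n (Suc t) y) \<and> E t x y" if "\<forall>n. D n t x" for t x
  proof -
    have "\<exists>y\<in>{y \<in> V (Suc t). E t x y}. \<forall>n. D n (Suc t) y"
    proof (rule finite_antimono_witness)
      show "\<exists>y\<in>{y \<in> V (Suc t). E t x y}. D n (Suc t) y" for n
        using that[rule_format, of "Suc n"] D_V by (auto simp: D_Suc)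
    qed (use fin anti in auto)
    then show ?thesis by blast
  qed
  obtain b where "\<And>t. \<forall>n. D n t (b t)" "\<And>t. E t (b t) (b (Suc t))"
    using dependent_nat_choice[where P = "\<lambda>t x. \<forall>n. D n t x" and Q = E] start ext by metis
  then show ?thesis using D_0 by blast
qed

section \<open>Subset constructions for the two parts of a certificate\<close>

definition init_atoms :: "'a pltl \<Rightarrow> 'a pltl set set" where
  "init_atoms \<phi> = {a \<in> Pow (basis \<phi>). (\<forall>\<chi>\<in>a. init_ok a \<chi>) \<and> holds a \<phi>}"

text \<open>The discharge set is empty, as in settling runs and in fulfilling runs before time
  \<open>j\<close>; one sequence of levels therefore serves every \<open>X\<close>.\<close>

definition post :: "'a pltl \<Rightarrow> 'a pltl set set \<Rightarrow> 'a set \<Rightarrow> 'a pltl set set" where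
  "post \<phi> A \<sigma> = {a' \<in> Pow (basis \<phi>). \<exists>a\<in>A. tableau_step {} a \<sigma> a'}"

text \<open>The breakpoint construction: once all tracked runs have left \<open>settled X\<close>, tracking is
  restarted from all reachable atoms.\<close>

definition safe_step ::
    "'a pltl \<Rightarrow> 'a pltl set \<Rightarrow> 'a pltl set set \<Rightarrow> 'a pltl set set \<Rightarrow> 'a set \<Rightarrow> 'a pltl set set" where
  "safe_step \<phi> X P' S \<sigma> = (if S = {} then P' else post \<phi> S \<sigma>) \<inter> settled X"

text \<open>A pair \<open>(a, D)\<close> is a run that ends in \<open>a\<close> and has met the formulae \<open>D\<close> since the last
  restart. The atom \<open>{}\<close> has no pending obligations, so reaching \<open>({}, mu_part X)\<close> completes
  a fulfilling run.\<close>

definition search_step ::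
    "'a pltl \<Rightarrow> 'a pltl set \<Rightarrow> 'a pltl set set \<Rightarrow> ('a pltl set \<times> 'a pltl set) set \<Rightarrow> 'a set \<Rightarrow>
      ('a pltl set \<times> 'a pltl set) set" where
  "search_step \<phi> X P' T \<sigma> =
     (if ({}, mu_part X) \<in> T then P' \<times> {{}}
      else {(a', D \<union> (a \<inter> mu_part X)) |a D a'.
        (a, D) \<in> T \<and> a' \<subseteq> basis \<phi> \<and> tableau_step (nu_part X) a \<sigma> a'})"

primrec level :: "'a pltl \<Rightarrow> 'a set word \<Rightarrow> nat \<Rightarrow> 'a pltl set set" where
  "level \<phi> w 0 = init_atoms \<phi>"
| "level \<phi> w (Suc t) = post \<phi> (level \<phi> w t) (w t)"

text \<open>The empty start acts as a breakpoint: tracking begins with the settled atoms of level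
  1.\<close>

primrec safe :: "'a pltl \<Rightarrow> 'a set word \<Rightarrow> 'a pltl set \<Rightarrow> nat \<Rightarrow> 'a pltl set set" where
  "safe \<phi> w X 0 = {}"
| "safe \<phi> w X (Suc t) = safe_step \<phi> X (level \<phi> w (Suc t)) (safe \<phi> w X t) (w t)"

primrec search ::
    "'a pltl \<Rightarrow> 'a set word \<Rightarrow> 'a pltl set \<Rightarrow> nat \<Rightarrow> ('a pltl set \<times> 'a pltl set) set" where
  "search \<phi> w X 0 = init_atoms \<phi> \<times> {{}}"
| "search \<phi> w X (Suc t) = search_step \<phi> X (level \<phi> w (Suc t)) (search \<phi> w X t) (w t)"

lemma finite_basis [simp]: "finite (basis \<phi>)"
  by (simp add: basis_def)

lemma finite_fixpoint_nodes [simp]: "finite (fixpoint_nodes \<phi>)"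
  by (simp add: fixpoint_nodes_def)

lemma level_subset: "level \<phi> w t \<subseteq> Pow (basis \<phi>)"
  by (cases t) (auto simp: init_atoms_def post_def)

lemma level_run:
  assumes "a \<in> level \<phi> w t"
  obtains b where "b t = a" "b 0 \<in> init_atoms \<phi>" "\<And>s. s \<le> t \<Longrightarrow> b s \<subseteq> basis \<phi>"
    "\<And>s. s < t \<Longrightarrow> tableau_step {} (b s) (w s) (b (Suc s))"
  using assms
proof (induction t arbitrary: a thesis)
  case 0
  show ?case by (rule 0(1)[of "\<lambda>_. a"]) (use 0(2) in \<open>auto simp: init_atoms_def\<close>)
next
  case (Suc t)
  then obtain a0 where a0: "a0 \<in> level \<phi> w t" "tableau_step {} a0 (w t) a" "a \<subseteq> basis \<phi>"
    by (auto simp: post_def)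
  from Suc.IH[OF _ a0(1)] obtain b where b: "b t = a0" "b 0 \<in> init_atoms \<phi>"
    "\<And>s. s \<le> t \<Longrightarrow> b s \<subseteq> basis \<phi>" "\<And>s. s < t \<Longrightarrow> tableau_step {} (b s) (w s) (b (Suc s))"
    by metis
  show ?case
    by (rule Suc.prems(1)[of "b(Suc t := a)"]) (use b a0 in \<open>auto simp: le_Suc_eq less_Suc_eq\<close>)
qed

lemma run_level:
  assumes "b 0 \<in> init_atoms \<phi>" "\<And>s. s \<le> t \<Longrightarrow> b s \<subseteq> basis \<phi>"
    "\<And>s. s < t \<Longrightarrow> tableau_step {} (b s) (w s) (b (Suc s))"
  shows "b t \<in> level \<phi> w t"
  using assms by (induction t) (auto simp: post_def)

lemma init_atoms_run:
  "tableau_run w N j b \<Longrightarrow> holds (b 0) \<phi> \<Longrightarrow> b 0 \<subseteq> basis \<phi> \<Longrightarrow> b 0 \<in> init_atoms \<phi>"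
  by (auto simp: init_atoms_def tableau_run_def)

lemma safe_subset_level: "safe \<phi> w X t \<subseteq> level \<phi> w t"
  by (induction t) (auto simp: safe_step_def post_def)

text \<open>After it has settled, a settling run joins the tracked set at the next breakpoint and
  never leaves it, so no further breakpoint occurs. Conversely, without breakpoints every tracked
  atom has a tracked predecessor; Koenig's lemma gives an infinite run, and a run reaching its first
  atom is put in front.\<close>

lemma settling_run_iff_safe:
  "settling_run \<phi> w X \<longleftrightarrow> (\<exists>i. \<forall>t\<ge>i. safe \<phi> w X t \<noteq> {})"
proof
  assume "settling_run \<phi> w X"
  then obtain b i where b: "tableau_run w {} 0 b" "holds (b 0) \<phi>" "\<And>t. b t \<subseteq> basis \<phi>"
    and i: "\<And>t. t \<ge> i \<Longrightarrow> b t \<in> settled X"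
    unfolding settling_run_def by blast
  have step: "tableau_step {} (b s) (w s) (b (Suc s))" for s
    using b(1) by (simp add: tableau_run_def)
  have level: "b t \<in> level \<phi> w t" for t
    by (rule run_level) (use init_atoms_run[OF b(1,2)] b(3) step in auto)
  show "\<exists>i. \<forall>t\<ge>i. safe \<phi> w X t \<noteq> {}"
  proof (rule ccontr)
    assume neg: "\<not> ?thesis"
    then obtain t0 where t0: "t0 \<ge> i" "safe \<phi> w X t0 = {}" by blast
    have "b t \<in> safe \<phi> w X t" if "t \<ge> Suc t0" for t
      using that
    proof (induction t rule: dec_induct)
      case base
      then show ?case
        using t0 i[of "Suc t0"] level[of "Suc t0"] by (simp add: safe_step_def)
    next
      case (step t)
      then show ?case
        using t0(1) i[of "Suc t"] b(3) \<open>\<And>s. tableau_step {} (b s) (w s) (b (Suc s))\<close>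
        by (auto simp: safe_step_def post_def)
    qed
    with neg show False by blast
  qed
next
  assume "\<exists>i. \<forall>t\<ge>i. safe \<phi> w X t \<noteq> {}"
  then obtain i where i: "\<And>t. t \<ge> i \<Longrightarrow> safe \<phi> w X t \<noteq> {}" by blast
  have "\<exists>b. \<forall>t. b t \<in> safe \<phi> w X (i + t) \<and> tableau_step {} (b t) (w (i + t)) (b (Suc t))"
  proof (rule koenig_layered)
    show "finite (safe \<phi> w X (i + t))" for t
      using safe_subset_level level_subset by (rule finite_subset[OF order_trans]) simp
    show "\<exists>x\<in>safe \<phi> w X (i + t). tableau_step {} x (w (i + t)) y"
      if "y \<in> safe \<phi> w X (i + Suc t)" for t y
      using that i[of "i + t"] by (auto simp: safe_step_def post_def)
  qed (use i in auto)
  then obtain b where b: "\<And>t. b t \<in> safe \<phi> w X (i + t)"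
    "\<And>t. tableau_step {} (b t) (w (i + t)) (b (Suc t))" by blast
  have "b 0 \<in> level \<phi> w i"
    using b(1)[of 0] safe_subset_level by fastforce
  then obtain c where c: "c i = b 0" "c 0 \<in> init_atoms \<phi>" "\<And>s. s \<le> i \<Longrightarrow> c s \<subseteq> basis \<phi>"
    "\<And>s. s < i \<Longrightarrow> tableau_step {} (c s) (w s) (c (Suc s))"
    using level_run by metis
  define d where "d = (\<lambda>s. if s \<le> i then c s else b (s - i))"
  have d_ge: "d s = b (s - i)" if "s \<ge> i" for s
    using that c(1) by (cases "s = i") (auto simp: d_def)
  have "tableau_step {} (d s) (w s) (d (Suc s))" for s
  proof (cases "s < i")
    case True
    then show ?thesis using c(4) by (simp add: d_def)
  next
    case False
    then show ?thesis using b(2)[of "s - i"] by (simp add: d_ge Suc_diff_le)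
  qed
  then have "tableau_run w {} 0 d"
    using c(2) by (simp add: tableau_run_def d_def init_atoms_def)
  moreover have "holds (d 0) \<phi>"
    using c(2) by (simp add: d_def init_atoms_def)
  moreover have "d t \<subseteq> basis \<phi>" for t
  proof (cases "t \<le> i")
    case False
    then have "d t \<in> safe \<phi> w X t" using b(1)[of "t - i"] by (simp add: d_ge)
    then show ?thesis using safe_subset_level level_subset by blast
  qed (use c(3) in \<open>simp add: d_def\<close>)
  \<comment> \<open>\<open>Suc i\<close> ensures that \<open>t\<close> is a successor, where
    \<open>safe\<close> is by definition intersected with \<open>settled X\<close>.\<close>
  moreover have "d t \<in> settled X" if "t \<ge> Suc i" for t
  proof -
    from that obtain s where "t = Suc s" by (cases t) auto
    moreover have "d t \<in> safe \<phi> w X t" using b(1)[of "t - i"] that by (simp add: d_ge)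
    ultimately show ?thesis by (simp add: safe_step_def)
  qed
  ultimately show "settling_run \<phi> w X"
    unfolding settling_run_def by blast
qed

text \<open>After the reset at \<open>j\<close> the pairs evolve without interruption up to
  \<open>t\<close>, so they unfold to runs. \<open>search_step\<close> records the claims of the
  source atom; hence \<open>D\<close> covers \<open>{j..<t}\<close> and leaves out
  \<open>t\<close>.\<close>

lemma search_run:
  assumes reset: "search \<phi> w X j = level \<phi> w j \<times> {{}}"
    and no_reset: "\<And>s. j \<le> s \<Longrightarrow> s < t \<Longrightarrow> ({}, mu_part X) \<notin> search \<phi> w X s"
    and "j \<le> t" and "(a, D) \<in> search \<phi> w X t"
  shows "\<exists>b. b t = a \<and> D = (\<Union>s\<in>{j..<t}. b s \<inter> mu_part X) \<and> b 0 \<in> init_atoms \<phi> \<and>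
    (\<forall>s\<le>t. b s \<subseteq> basis \<phi>) \<and>
    (\<forall>s<t. tableau_step (if s < j then {} else nu_part X) (b s) (w s) (b (Suc s)))"
  using \<open>j \<le> t\<close> no_reset \<open>(a, D) \<in> search \<phi> w X t\<close>
proof (induction t arbitrary: a D rule: dec_induct)
  case base
  then have a: "a \<in> level \<phi> w j" and "D = {}" using reset by auto
  obtain b where "b j = a" "b 0 \<in> init_atoms \<phi>" "\<And>s. s \<le> j \<Longrightarrow> b s \<subseteq> basis \<phi>"
    "\<And>s. s < j \<Longrightarrow> tableau_step {} (b s) (w s) (b (Suc s))"
    using level_run[OF a] by blast
  with \<open>D = {}\<close> show ?case by (intro exI[of _ b]) simp
next
  case (step t)
  from step.prems(2) step.prems(1)[of t] step.hyps obtain a0 D0 where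
    a0: "(a0, D0) \<in> search \<phi> w X t" "D = D0 \<union> (a0 \<inter> mu_part X)" "a \<subseteq> basis \<phi>"
      "tableau_step (nu_part X) a0 (w t) a"
    by (auto simp: search_step_def)
  obtain b where b: "b t = a0" "D0 = (\<Union>s\<in>{j..<t}. b s \<inter> mu_part X)" "b 0 \<in> init_atoms \<phi>"
    "\<forall>s\<le>t. b s \<subseteq> basis \<phi>"
    "\<forall>s<t. tableau_step (if s < j then {} else nu_part X) (b s) (w s) (b (Suc s))"
    using step.IH[OF _ a0(1)] step.prems(1) by auto
  have "D = (\<Union>s\<in>{j..<Suc t}. (b(Suc t := a)) s \<inter> mu_part X)"
    using a0(2) b(1,2) step.hyps by (auto simp: atLeastLessThanSuc)
  then show ?case
    using b a0 step.hyps
    by (intro exI[of _ "b(Suc t := a)"]) (auto simp: le_Suc_eq less_Suc_eq)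
qed

lemma tableau_step_empty [simp]: "tableau_step N {} \<sigma> {}"
  by (simp add: tableau_step_def)

text \<open>A success resets the search one step later, at the time that becomes \<open>j\<close>;
  the following success completes a fulfilling run for this \<open>j\<close>.\<close>

lemma search_sound:
  assumes acc: "\<And>i. \<exists>t\<ge>i. ({}, mu_part X) \<in> search \<phi> w X t"
  shows "\<exists>j\<ge>i. fulfilling_run \<phi> w X j"
proof -
  obtain t0 where t0: "t0 \<ge> i" "({}, mu_part X) \<in> search \<phi> w X t0" using acc by blast
  define j where "j = Suc t0"
  have reset: "search \<phi> w X j = level \<phi> w j \<times> {{}}"
    using t0 by (simp add: j_def search_step_def)
  \<comment> \<open>The least success from \<open>j\<close> on is chosen, so that no reset
    intervenes.\<close>
  define t where "t = (LEAST t. t \<ge> j \<and> ({}, mu_part X) \<in> search \<phi> w X t)"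
  have t: "t \<ge> j" "({}, mu_part X) \<in> search \<phi> w X t"
    using LeastI_ex[of "\<lambda>t. t \<ge> j \<and> ({}, mu_part X) \<in> search \<phi> w X t"] acc[of j]
    by (auto simp: t_def)
  have "({}, mu_part X) \<notin> search \<phi> w X s" if "j \<le> s" "s < t" for s
    using that not_less_Least[of s "\<lambda>t. t \<ge> j \<and> ({}, mu_part X) \<in> search \<phi> w X t"]
    by (auto simp: t_def)
  from search_run[OF reset this t] obtain b where b: "b t = {}"
    "mu_part X = (\<Union>s\<in>{j..<t}. b s \<inter> mu_part X)" "b 0 \<in> init_atoms \<phi>" "\<forall>s\<le>t. b s \<subseteq> basis \<phi>"
    "\<forall>s<t. tableau_step (if s < j then {} else nu_part X) (b s) (w s) (b (Suc s))"
    by auto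
  \<comment> \<open>The run found ends in the empty atom, so it can be padded with empty
    atoms.\<close>
  define b' where "b' = (\<lambda>s. if s \<le> t then b s else {})"
  have b'_ge: "b' s = {}" if "s \<ge> t" for s
    using that b(1) by (cases "s = t") (auto simp: b'_def)
  have "tableau_step (if s < j then {} else nu_part X) (b' s) (w s) (b' (Suc s))" for s
  proof (cases "s < t")
    case True
    then show ?thesis using b(5) by (simp add: b'_def)
  next
    case False
    then show ?thesis by (simp add: b'_ge)
  qed
  then have "tableau_run w (nu_part X) j b'"
    using b(3) by (simp add: tableau_run_def b'_def init_atoms_def)
  moreover have "\<exists>s\<ge>j. \<chi> \<in> b' s" if "\<chi> \<in> mu_part X" for \<chi>
  proof -
    from that b(2) obtain s where "s \<in> {j..<t}" "\<chi> \<in> b s" by blast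
    then show ?thesis by (intro exI[of _ s]) (auto simp: b'_def)
  qed
  ultimately have "fulfilling_run \<phi> w X j"
    unfolding fulfilling_run_def using b(3,4) b'_ge
    by (intro exI[of _ b'] exI[of _ t]) (auto simp: b'_def init_atoms_def)
  then show ?thesis using t0(1) by (auto simp: j_def intro!: exI[of _ "Suc t0"])
qed

text \<open>Without a success from \<open>i\<close> on, the search continues undisturbed after its
  last reset \<open>j\<close>; it then follows the fulfilling run for this \<open>j\<close> to its
  empty tail, which is a success.\<close>

lemma search_complete:
  assumes "\<And>j. fulfilling_run \<phi> w X j"
  shows "\<exists>t\<ge>i. ({}, mu_part X) \<in> search \<phi> w X t"
proof (rule ccontr)
  assume neg: "\<not> ?thesis"
  \<comment> \<open>This is the last reset up to \<open>i\<close>; the initial value of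
    \<open>search\<close> counts as a reset at 0.\<close>
  have "\<exists>j\<le>i. search \<phi> w X j = level \<phi> w j \<times> {{}} \<and>
      (\<forall>s. j \<le> s \<and> s < i \<longrightarrow> ({}, mu_part X) \<notin> search \<phi> w X s)"
  proof (induction i)
    case (Suc i)
    show ?case
    proof (cases "({}, mu_part X) \<in> search \<phi> w X i")
      case True
      then show ?thesis by (intro exI[of _ "Suc i"]) (auto simp: search_step_def)
    next
      case False
      then show ?thesis using Suc by (metis le_SucI less_Suc_eq)
    qed
  qed simp
  then obtain j where j: "search \<phi> w X j = level \<phi> w j \<times> {{}}"
    and no_reset: "\<And>s. j \<le> s \<Longrightarrow> ({}, mu_part X) \<notin> search \<phi> w X s"
    using neg by (metis linorder_not_less)
  obtain b k where b: "tableau_run w (nu_part X) j b" "holds (b 0) \<phi>" "\<And>t. b t \<subseteq> basis \<phi>"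
    and k: "\<And>t. t \<ge> k \<Longrightarrow> b t = {}" and mu: "\<And>\<chi>. \<chi> \<in> mu_part X \<Longrightarrow> \<exists>t\<ge>j. \<chi> \<in> b t"
    using assms[of j] unfolding fulfilling_run_def by blast
  have b_step: "tableau_step (if s < j then {} else nu_part X) (b s) (w s) (b (Suc s))" for s
    using b(1) by (simp add: tableau_run_def)
  have "tableau_step {} (b s) (w s) (b (Suc s))" if "s < j" for s
    using b_step[of s] that by simp
  then have level: "b j \<in> level \<phi> w j"
    using init_atoms_run[OF b(1,2)] b(3) by (intro run_level) auto
  have "(b t, \<Union>s\<in>{j..<t}. b s \<inter> mu_part X) \<in> search \<phi> w X t" if "t \<ge> j" for t
    using that
  proof (induction t rule: dec_induct)
    case base
    then show ?case using level by (simp add: j)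
  next
    case (step t)
    have "(\<Union>s\<in>{j..<Suc t}. b s \<inter> mu_part X) =
        (\<Union>s\<in>{j..<t}. b s \<inter> mu_part X) \<union> (b t \<inter> mu_part X)"
      using step.hyps by (auto simp: atLeastLessThanSuc)
    then show ?case
      using step b_step[of t] b(3) no_reset[of t] by (auto simp: search_step_def)
  qed
  \<comment> \<open>At \<open>max j k\<close> tracking has begun, the atom is empty, and the claims
    of \<open>mu_part X\<close> made from \<open>j\<close> on lie strictly before.\<close>
  then have "(b (max j k), \<Union>s\<in>{j..<max j k}. b s \<inter> mu_part X) \<in> search \<phi> w X (max j k)"
    by simp
  moreover have "(\<Union>s\<in>{j..<max j k}. b s \<inter> mu_part X) = mu_part X"
  proof (intro equalityI subsetI)
    fix \<chi> assume \<chi>: "\<chi> \<in> mu_part X"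
    then obtain t where t: "t \<ge> j" "\<chi> \<in> b t" using mu by blast
    then have "t < k" using k[of t] by (cases "t < k") auto
    with t \<chi> show "\<chi> \<in> (\<Union>s\<in>{j..<max j k}. b s \<inter> mu_part X)" by force
  qed auto
  ultimately show False
    using no_reset[of "max j k"] k[of "max j k"] by simp
qed

theorem sat_iff_safe_search:
  "sat w 0 \<phi> \<longleftrightarrow> (\<exists>X\<in>Pow (fixpoint_nodes \<phi>).
     (\<exists>i. \<forall>t\<ge>i. safe \<phi> w X t \<noteq> {}) \<and> (\<forall>i. \<exists>t\<ge>i. ({}, mu_part X) \<in> search \<phi> w X t))"
proof
  assume "sat w 0 \<phi>"
  then obtain X where "X \<subseteq> fixpoint_nodes \<phi>" "settling_run \<phi> w X" "\<And>j. fulfilling_run \<phi> w X j"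
    using certificate_complete by blast
  then show "\<exists>X\<in>Pow (fixpoint_nodes \<phi>).
     (\<exists>i. \<forall>t\<ge>i. safe \<phi> w X t \<noteq> {}) \<and> (\<forall>i. \<exists>t\<ge>i. ({}, mu_part X) \<in> search \<phi> w X t)"
    using search_complete[of \<phi> w X] settling_run_iff_safe[of \<phi> w X] by blast
next
  assume "\<exists>X\<in>Pow (fixpoint_nodes \<phi>).
     (\<exists>i. \<forall>t\<ge>i. safe \<phi> w X t \<noteq> {}) \<and> (\<forall>i. \<exists>t\<ge>i. ({}, mu_part X) \<in> search \<phi> w X t)"
  then obtain X where X: "X \<subseteq> fixpoint_nodes \<phi>" "settling_run \<phi> w X"
    "\<And>i. \<exists>t\<ge>i. ({}, mu_part X) \<in> search \<phi> w X t"
    using settling_run_iff_safe by blast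
  show "sat w 0 \<phi>"
    by (rule certificate_sound[OF X(1,2)]) (rule search_sound[OF X(3)])
qed

subsection \<open>The Rabin automaton\<close>

primrec det_run :: "('q \<Rightarrow> 'b \<Rightarrow> 'q) \<Rightarrow> 'q \<Rightarrow> 'b word \<Rightarrow> nat \<Rightarrow> 'q" where
  "det_run \<delta> q w 0 = q"
| "det_run \<delta> q w (Suc t) = \<delta> (det_run \<delta> q w t) (w t)"

text \<open>A finite set visited infinitely often has a member visited infinitely often. This turns
  Rabin conditions on \<open>limit\<close> into conditions on visit times.\<close>

lemma limit_disjoint_finite_iff:
  assumes "finite B"
  shows "limit r \<inter> B = {} \<longleftrightarrow> (\<exists>n. \<forall>t\<ge>n. r t \<notin> B)"
proof -
  have "x \<in> limit r \<longleftrightarrow> \<not> (\<forall>\<^sub>F t in sequentially. r t \<noteq> x)" for x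
    by (simp add: limit_def INFM_nat_le eventually_sequentially)
  then have "limit r \<inter> B = {} \<longleftrightarrow> (\<forall>x\<in>B. \<forall>\<^sub>F t in sequentially. r t \<noteq> x)"
    by blast
  also have "\<dots> \<longleftrightarrow> (\<forall>\<^sub>F t in sequentially. \<forall>x\<in>B. r t \<noteq> x)"
    by (rule eventually_ball_finite_distrib[OF assms, symmetric])
  also have "\<dots> \<longleftrightarrow> (\<exists>n. \<forall>t\<ge>n. r t \<notin> B)"
    by (auto simp: eventually_sequentially)
  finally show ?thesis .
qed

text \<open>\<open>\<delta>\<close> is total, so each word has exactly one run, the renamed
  \<open>det_run\<close>. States become numbers through an injection on \<open>Q\<close>; different
  indices may yield the same pair, hence the inequality for \<open>pairs\<close>.\<close>

lemma det_rabin_of_transition_system: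
  fixes \<delta> :: "'q \<Rightarrow> 'b \<Rightarrow> 'q" and E F :: "'i \<Rightarrow> 'q set"
  assumes "finite Q" "q\<^sub>0 \<in> Q" and \<delta>: "\<And>q \<sigma>. q \<in> Q \<Longrightarrow> \<sigma> \<in> \<Sigma> \<Longrightarrow> \<delta> q \<sigma> \<in> Q" and "finite I"
  obtains A :: "(nat, 'b) rabin" where "det_rabin \<Sigma> A" "card (states A) = card Q"
    "card (pairs A) \<le> card I"
    "\<And>w. range w \<subseteq> \<Sigma> \<Longrightarrow> rabin_accepts A w \<longleftrightarrow>
      (\<exists>i\<in>I. (\<exists>n. \<forall>t\<ge>n. det_run \<delta> q\<^sub>0 w t \<notin> E i) \<and> (\<forall>n. \<exists>t\<ge>n. det_run \<delta> q\<^sub>0 w t \<in> F i))"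
proof -
  obtain f :: "'q \<Rightarrow> nat" where f: "inj_on f Q"
    using finite_imp_inj_to_nat_seg[OF \<open>finite Q\<close>] by blast
  define A :: "(nat, 'b) rabin" where
    "A = \<lparr>states = f ` Q, initial = f q\<^sub>0, trans_fun = \<lambda>x \<sigma>. Some (f (\<delta> (inv_into Q f x) \<sigma>)),
      pairs = (\<lambda>i. (f ` (E i \<inter> Q), f ` (F i \<inter> Q))) ` I\<rparr>"
  have "det_rabin \<Sigma> A"
    using assms f by (auto simp: det_rabin_def A_def)
  moreover have "card (states A) = card Q"
    using f by (simp add: A_def card_image)
  moreover have "card (pairs A) \<le> card I"
    using \<open>finite I\<close> by (simp add: A_def card_image_le)
  moreover have "rabin_accepts A w \<longleftrightarrow> (\<exists>i\<in>I.
      (\<exists>n. \<forall>t\<ge>n. det_run \<delta> q\<^sub>0 w t \<notin> E i) \<and> (\<forall>n. \<exists>t\<ge>n. det_run \<delta> q\<^sub>0 w t \<in> F i))"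
    if w: "range w \<subseteq> \<Sigma>" for w
  proof -
    let ?\<rho> = "det_run \<delta> q\<^sub>0 w"
    have \<rho>: "?\<rho> t \<in> Q" for t
    proof (induction t)
      case (Suc t)
      have "w t \<in> \<Sigma>" using w by blast
      with Suc show ?case by (simp add: \<delta>)
    qed (use \<open>q\<^sub>0 \<in> Q\<close> in simp)
    have run: "is_run A w r \<longleftrightarrow> r = f \<circ> ?\<rho>" for r
    proof
      assume r: "is_run A w r"
      have "r t = f (?\<rho> t)" for t
      proof (induction t)
        case (Suc t)
        have "Some (r (Suc t)) = Some (f (\<delta> (inv_into Q f (r t)) (w t)))"
          using r by (simp add: is_run_def A_def)
        then show ?case using Suc \<rho> f by simp
      qed (use r in \<open>simp add: is_run_def A_def\<close>)
      then show "r = f \<circ> ?\<rho>" by auto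
    qed (use \<rho> f in \<open>auto simp: is_run_def A_def\<close>)
    have mem: "f (?\<rho> t) \<in> f ` (B \<inter> Q) \<longleftrightarrow> ?\<rho> t \<in> B" for B t
      using \<rho> f by (auto dest: inj_onD)
    have lim: "limit (f \<circ> ?\<rho>) \<inter> f ` (B \<inter> Q) = {} \<longleftrightarrow> (\<exists>n. \<forall>t\<ge>n. ?\<rho> t \<notin> B)" for B
      using \<open>finite Q\<close> by (simp add: limit_disjoint_finite_iff mem)
    show ?thesis
      by (simp add: rabin_accepts_def run lim) (simp add: A_def lim)
  qed
  ultimately show ?thesis by (rule that)
qed

section \<open>The product automaton over all guesses\<close>

type_synonym 'a aut_state =
  "'a pltl set set \<times> ('a pltl set \<Rightarrow> 'a pltl set set) \<times>
    ('a pltl set \<Rightarrow> ('a pltl set \<times> 'a pltl set) set)"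

definition aut_init :: "'a pltl \<Rightarrow> 'a aut_state" where
  "aut_init \<phi> = (init_atoms \<phi>, \<lambda>X\<in>Pow (fixpoint_nodes \<phi>). {},
     \<lambda>X\<in>Pow (fixpoint_nodes \<phi>). init_atoms \<phi> \<times> {{}})"

definition aut_step :: "'a pltl \<Rightarrow> 'a aut_state \<Rightarrow> 'a set \<Rightarrow> 'a aut_state" where
  "aut_step \<phi> = (\<lambda>(P, S, T) \<sigma>.
     (post \<phi> P \<sigma>,
      \<lambda>X\<in>Pow (fixpoint_nodes \<phi>). safe_step \<phi> X (post \<phi> P \<sigma>) (S X) \<sigma>,
      \<lambda>X\<in>Pow (fixpoint_nodes \<phi>). search_step \<phi> X (post \<phi> P \<sigma>) (T X) \<sigma>))"

text \<open>The function components are extensional on \<open>Pow (fixpoint_nodes \<phi>)\<close>,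
  which makes them finite in number and countable by \<open>card_PiE\<close>.\<close>

definition aut_states :: "'a pltl \<Rightarrow> 'a aut_state set" where
  "aut_states \<phi> = Pow (Pow (basis \<phi>)) \<times>
     (Pow (fixpoint_nodes \<phi>) \<rightarrow>\<^sub>E Pow (Pow (basis \<phi>))) \<times>
     (Pow (fixpoint_nodes \<phi>) \<rightarrow>\<^sub>E Pow (Pow (basis \<phi>) \<times> Pow (fixpoint_nodes \<phi>)))"

lemma det_run_aut:
  "det_run (aut_step \<phi>) (aut_init \<phi>) w t = (level \<phi> w t,
     \<lambda>X\<in>Pow (fixpoint_nodes \<phi>). safe \<phi> w X t, \<lambda>X\<in>Pow (fixpoint_nodes \<phi>). search \<phi> w X t)"
  by (induction t) (auto simp: aut_init_def aut_step_def fun_eq_iff)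

lemma finite_aut_states: "finite (aut_states \<phi>)"
  unfolding aut_states_def by (intro finite_cartesian_product finite_PiE) auto

lemma aut_init_states: "aut_init \<phi> \<in> aut_states \<phi>"
  by (auto simp: aut_init_def aut_states_def init_atoms_def)

lemma post_subset: "post \<phi> P \<sigma> \<subseteq> Pow (basis \<phi>)"
  by (auto simp: post_def)

lemma safe_step_subset: "P' \<subseteq> Pow (basis \<phi>) \<Longrightarrow> safe_step \<phi> X P' S \<sigma> \<subseteq> Pow (basis \<phi>)"
  by (auto simp: safe_step_def post_def)

lemma search_step_subset:
  assumes "P' \<subseteq> Pow (basis \<phi>)" "X \<subseteq> fixpoint_nodes \<phi>"
    "T \<subseteq> Pow (basis \<phi>) \<times> Pow (fixpoint_nodes \<phi>)"
  shows "search_step \<phi> X P' T \<sigma> \<subseteq> Pow (basis \<phi>) \<times> Pow (fixpoint_nodes \<phi>)"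
proof (cases "({}, mu_part X) \<in> T")
  case True
  then show ?thesis using assms(1) by (auto simp: search_step_def)
next
  case False
  have "D \<subseteq> fixpoint_nodes \<phi>" if "(a, D) \<in> T" for a D
    using that assms(3) by blast
  moreover have "mu_part X \<subseteq> fixpoint_nodes \<phi>"
    using assms(2) by (auto simp: mu_part_def)
  ultimately show ?thesis using False by (auto simp: search_step_def)
qed

lemma aut_step_states:
  assumes "q \<in> aut_states \<phi>"
  shows "aut_step \<phi> q \<sigma> \<in> aut_states \<phi>"
proof -
  obtain P S T where q: "q = (P, S, T)" by (cases q)
  have T: "T X \<subseteq> Pow (basis \<phi>) \<times> Pow (fixpoint_nodes \<phi>)" if "X \<subseteq> fixpoint_nodes \<phi>" for X
  proof -
    have "T \<in> Pow (fixpoint_nodes \<phi>) \<rightarrow>\<^sub>E Pow (Pow (basis \<phi>) \<times> Pow (fixpoint_nodes \<phi>))"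
      using assms by (simp add: q aut_states_def)
    from PiE_mem[OF this] that show ?thesis by (metis PowD PowI)
  qed
  show ?thesis
    unfolding q aut_step_def aut_states_def
    by (simp add: post_subset safe_step_subset search_step_subset T)
qed

section \<open>Counting states and pairs\<close>

lemma length_filter_disj:
  "length (filter (\<lambda>x. P x \<or> Q x) xs) \<le> length (filter P xs) + length (filter Q xs)"
  by (induction xs) auto

text \<open>Different nodes may carry equal subtrees, which the set identifies; hence only an upper
  bound.\<close>

lemma card_basis: "card (basis \<phi>) \<le> num_future_prop \<phi> + num_past \<phi>"
proof -
  have "basis \<phi> = set (filter (\<lambda>\<chi>. (is_future \<chi> \<or> is_propositional \<chi>) \<or> is_past \<chi>) (nodes \<phi>))"
    by (auto simp: basis_def)
  then have "card (basis \<phi>) \<le>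
      length (filter (\<lambda>\<chi>. (is_future \<chi> \<or> is_propositional \<chi>) \<or> is_past \<chi>) (nodes \<phi>))"
    by (simp only: card_length)
  also have "\<dots> \<le> num_future_prop \<phi> + num_past \<phi>"
    unfolding num_future_prop_def num_past_def by (rule length_filter_disj)
  finally show ?thesis .
qed

text \<open>Fixpoint nodes are future nodes. As guesses are subsets of
  \<open>fixpoint_nodes \<phi>\<close>, this bounds the number of Rabin pairs.\<close>

lemma card_fixpoint_nodes: "card (fixpoint_nodes \<phi>) \<le> num_future_prop \<phi>"
proof -
  have "is_future \<chi>" if "is_mu \<chi> \<or> is_nu \<chi>" for \<chi> :: "'a pltl"
    using that by (cases \<chi>) auto
  then have "fixpoint_nodes \<phi> \<subseteq> set (filter (\<lambda>\<chi>. is_future \<chi> \<or> is_propositional \<chi>) (nodes \<phi>))"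
    by (auto simp: fixpoint_nodes_def)
  then have "card (fixpoint_nodes \<phi>) \<le>
      card (set (filter (\<lambda>\<chi>. is_future \<chi> \<or> is_propositional \<chi>) (nodes \<phi>)))"
    by (intro card_mono) auto
  also have "\<dots> \<le> num_future_prop \<phi>"
    unfolding num_future_prop_def by (rule card_length)
  finally show ?thesis .
qed

lemma card_aut_states:
  assumes "N = num_future_prop \<phi> + num_past \<phi>" "N \<ge> 1"
  shows "card (aut_states \<phi>) \<le> 2 ^ (2 ^ (5 * N))"
proof -
  define b where "b = card (basis \<phi>)"
  define f where "f = card (fixpoint_nodes \<phi>)"
  have le: "b \<le> N" "f \<le> N"
    using card_basis[of \<phi>] card_fixpoint_nodes[of \<phi>] assms(1) by (simp_all add: b_def f_def)
  \<comment> \<open>For each of the \<open>2 ^ f\<close> sets \<open>X\<close>, a state stores one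
    of \<open>2 ^ (2 ^ b)\<close> tracked sets and one of \<open>2 ^ (2 ^ b * 2 ^ f)\<close> search
    sets.\<close>
  have "card (aut_states \<phi>) =
      2 ^ (2 ^ b) * ((2 ^ (2 ^ b)) ^ (2 ^ f) * (2 ^ (2 ^ b * 2 ^ f)) ^ (2 ^ f))"
    by (simp add: aut_states_def card_cartesian_product card_PiE card_Pow b_def f_def)
  also have "\<dots> = 2 ^ (2 ^ b + (2 ^ b * 2 ^ f + 2 ^ b * 2 ^ f * 2 ^ f))"
    by (simp add: power_add power_mult)
  also have "\<dots> \<le> 2 ^ (2 ^ (5 * N))"
  proof (rule power_increasing)
    \<comment> \<open>Each of the three summands is at most \<open>2 ^ (3 * N)\<close>; the factor 4
      covers their number, and \<open>N \<ge> 1\<close> absorbs it into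
      \<open>5 * N\<close>.\<close>
    have bf: "(2::nat) ^ b \<le> 2 ^ N" "(2::nat) ^ f \<le> 2 ^ N" "(1::nat) \<le> 2 ^ N"
      using le by (auto intro: power_increasing)
    have "(2::nat) ^ b \<le> 2 ^ N * 2 ^ N * 2 ^ N"
      using mult_mono[OF mult_mono[OF bf(1,3)] bf(3)] by simp
    moreover have "(2::nat) ^ b * 2 ^ f \<le> 2 ^ N * 2 ^ N * 2 ^ N"
      using mult_mono[OF mult_mono[OF bf(1,2)] bf(3)] by simp
    moreover have "(2::nat) ^ b * 2 ^ f * 2 ^ f \<le> 2 ^ N * 2 ^ N * 2 ^ N"
      using bf by (intro mult_mono) auto
    ultimately have "(2::nat) ^ b + (2 ^ b * 2 ^ f + 2 ^ b * 2 ^ f * 2 ^ f) \<le>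
        4 * (2 ^ N * 2 ^ N * 2 ^ N)"
      by linarith
    also have "\<dots> = 2 ^ (3 * N + 2)"
      by (simp add: power_add numeral_3_eq_3)
    also have "\<dots> \<le> 2 ^ (5 * N)"
      using \<open>N \<ge> 1\<close> by (intro power_increasing) auto
    finally show "(2::nat) ^ b + (2 ^ b * 2 ^ f + 2 ^ b * 2 ^ f * 2 ^ f) \<le> 2 ^ (5 * N)" .
  qed simp
  finally show ?thesis .
qed

theorem corollary22:
  shows "\<exists>c :: nat. \<forall>(\<phi> :: 'a pltl) (n :: nat) (m :: nat).
    n = num_future_prop \<phi> \<longrightarrow> m = num_past \<phi> \<longrightarrow>
    (\<exists>A :: (nat, 'a set) rabin.
       det_rabin (Pow (Var \<phi>)) A \<and>
       rabin_language (Pow (Var \<phi>)) A = {w. range w \<subseteq> Pow (Var \<phi>) \<and> sat w 0 \<phi>} \<and>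
       (n + m \<ge> 1 \<longrightarrow> card (states A) \<le> 2 ^ (2 ^ (c * (n + m)))) \<and>
       card (pairs A) \<le> 2 ^ n)"
proof (intro exI[of _ 5] allI impI)
  fix \<phi> :: "'a pltl" and n m :: nat
  assume n: "n = num_future_prop \<phi>" and m: "m = num_past \<phi>"
  \<comment> \<open>\<open>E X\<close> consists of the breakpoint states, to be avoided eventually,
    and \<open>F X\<close> of the success states of the search.\<close>
  define E where "E = (\<lambda>X. {q :: 'a aut_state. fst (snd q) X = {}})"
  define F where "F = (\<lambda>X. {q :: 'a aut_state. ({}, mu_part X) \<in> snd (snd q) X})"
  obtain A :: "(nat, 'a set) rabin" where A: "det_rabin (Pow (Var \<phi>)) A"
    "card (states A) = card (aut_states \<phi>)" "card (pairs A) \<le> card (Pow (fixpoint_nodes \<phi>))"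
    and acc: "\<And>w. range w \<subseteq> Pow (Var \<phi>) \<Longrightarrow> rabin_accepts A w \<longleftrightarrow> (\<exists>X\<in>Pow (fixpoint_nodes \<phi>).
      (\<exists>n. \<forall>t\<ge>n. det_run (aut_step \<phi>) (aut_init \<phi>) w t \<notin> E X) \<and>
      (\<forall>n. \<exists>t\<ge>n. det_run (aut_step \<phi>) (aut_init \<phi>) w t \<in> F X))"
    by (rule det_rabin_of_transition_system[of "aut_states \<phi>" "aut_init \<phi>" "Pow (Var \<phi>)"
          "aut_step \<phi>" "Pow (fixpoint_nodes \<phi>)" E F])
      (simp_all only: finite_aut_states aut_init_states aut_step_states finite_Pow_iff
        finite_fixpoint_nodes)
  have "rabin_accepts A w \<longleftrightarrow> sat w 0 \<phi>" if "range w \<subseteq> Pow (Var \<phi>)" for w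
    unfolding acc[OF that] sat_iff_safe_search det_run_aut E_def F_def
    by (intro bex_cong) auto
  then have "rabin_language (Pow (Var \<phi>)) A = {w. range w \<subseteq> Pow (Var \<phi>) \<and> sat w 0 \<phi>}"
    by (auto simp: rabin_language_def)
  moreover have "card (states A) \<le> 2 ^ (2 ^ (5 * (n + m)))" if "n + m \<ge> 1"
    using card_aut_states[of "n + m" \<phi>] that A(2) n m by simp
  moreover have "card (pairs A) \<le> 2 ^ n"
  proof -
    have "card (pairs A) \<le> 2 ^ card (fixpoint_nodes \<phi>)"
      using A(3) by (simp add: card_Pow)
    also have "\<dots> \<le> 2 ^ n"
      using card_fixpoint_nodes[of \<phi>] n by (intro power_increasing) auto
    finally show ?thesis .
  qed
  ultimately show "\<exists>A :: (nat, 'a set) rabin.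
       det_rabin (Pow (Var \<phi>)) A \<and>
       rabin_language (Pow (Var \<phi>)) A = {w. range w \<subseteq> Pow (Var \<phi>) \<and> sat w 0 \<phi>} \<and>
       (n + m \<ge> 1 \<longrightarrow> card (states A) \<le> 2 ^ (2 ^ (5 * (n + m)))) \<and>
       card (pairs A) \<le> 2 ^ n"
    using A(1) by blast
qed

end
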